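(* Fix an integer $k\ge1$. For $n\ge1$ let $\mathcal{P}_n=\mathcal{P}(2k+1,\ldots,2k+1)$ be the pretzel link with $n$ tangles, each consisting of $2k+1$ crossings. Then $M(V_{\mathcal{P}_n}(t))\to\infty$ as $n\to\infty$.
   Context: $\mathcal{P}(a_1,\ldots,a_n)$ denotes the pretzel link formed by $n$ vertical twist regions (two-strand twist tangles) with $a_1,\ldots,a_n$ half-twists placed side by side and connected in the standard cyclic way; $\mathcal{P}_n$ is a knot if $n$ is odd and a two-component link if $n$ is even. $V_L(t)$ is the Jones polynomial, and $M$ is the Mahler measure $M(f)=\exp\int_0^1\log|f(e^{2\pi i\theta})|\,d\theta$, which is unaffected by monomial factors (including fractional powers of $t$). *)

theory Defs
  imports "HOL-Analysis.Analysis"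
begin

text \<open>
Standard diagram of the pretzel link P(c,...,c) with n vertical twist regions,
each having c crossings.  Crossing (i,j): region i < n, position j < c (top to
bottom).  Every crossing has four endpoints (i,j,p) with
p = 0 (top-left), 1 (top-right), 2 (bottom-left), 3 (bottom-right).
\<close>

definition pretzel_crossings :: "nat \<Rightarrow> nat \<Rightarrow> (nat \<times> nat) set" where
  "pretzel_crossings n c = {0..<n} \<times> {0..<c}"

definition pretzel_endpoints :: "nat \<Rightarrow> nat \<Rightarrow> (nat \<times> nat \<times> nat) set" where
  "pretzel_endpoints n c = {(i,j,p). i < n \<and> j < c \<and> p < 4}"

text \<open>Arcs of the diagram: inside a twist region the bottom endpoints of
crossing j are joined to the top endpoints of crossing j+1; the tops (resp.
bottoms) of consecutive regions are joined cyclically.\<close>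

definition pretzel_arcs :: "nat \<Rightarrow> nat \<Rightarrow> ((nat \<times> nat \<times> nat) \<times> (nat \<times> nat \<times> nat)) set" where
  "pretzel_arcs n c =
     {((i,j,2),(i,Suc j,0)) | i j. i < n \<and> Suc j < c}
   \<union> {((i,j,3),(i,Suc j,1)) | i j. i < n \<and> Suc j < c}
   \<union> {((i,0,1),(Suc i mod n,0,0)) | i. i < n}
   \<union> {((i,c-1,3),(Suc i mod n,c-1,2)) | i. i < n}"

text \<open>Kauffman state: S is the set of crossings receiving the A-smoothing
(joining top-left with top-right and bottom-left with bottom-right); all other
crossings receive the B-smoothing (joining top-left with bottom-left and
top-right with bottom-right).  All crossings of P(c,...,c), c > 0, have the
same type, so this is a consistent choice (the opposite choice gives the
mirror image, which changes V(t) to V(1/t) and does not change M).\<close>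

definition pretzel_smoothing ::
  "nat \<Rightarrow> nat \<Rightarrow> (nat \<times> nat) set \<Rightarrow> ((nat \<times> nat \<times> nat) \<times> (nat \<times> nat \<times> nat)) set" where
  "pretzel_smoothing n c S =
     {((i,j,0),(i,j,1)) | i j. (i,j) \<in> S}
   \<union> {((i,j,2),(i,j,3)) | i j. (i,j) \<in> S}
   \<union> {((i,j,0),(i,j,2)) | i j. (i,j) \<in> pretzel_crossings n c - S}
   \<union> {((i,j,1),(i,j,3)) | i j. (i,j) \<in> pretzel_crossings n c - S}"

text \<open>Number of loops of the state S = number of connected components of
the graph formed by the arcs and the smoothing edges.\<close>

definition pretzel_loops :: "nat \<Rightarrow> nat \<Rightarrow> (nat \<times> nat) set \<Rightarrow> nat" where
  "pretzel_loops n c S =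
     (let R = pretzel_arcs n c \<union> pretzel_smoothing n c S
      in card (pretzel_endpoints n c // ((R \<union> R\<inverse>)\<^sup>*)))"

text \<open>Kauffman bracket (state sum), evaluated at A.\<close>

definition pretzel_bracket :: "nat \<Rightarrow> nat \<Rightarrow> complex \<Rightarrow> complex" where
  "pretzel_bracket n c A =
     (\<Sum>S\<in>Pow (pretzel_crossings n c).
        A powi (int (card S) - int (card (pretzel_crossings n c - S)))
        * (- (A^2) - inverse (A^2)) ^ (pretzel_loops n c S - 1))"

text \<open>Jones polynomial V(t) = (-A^3)^(-w) <D> with A = t^(-1/4), w the writhe
of the (oriented) diagram; evaluated here as a function of A.\<close>

definition pretzel_jones_A :: "int \<Rightarrow> nat \<Rightarrow> nat \<Rightarrow> complex \<Rightarrow> complex" where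
  "pretzel_jones_A w n c A = (- (A^3)) powi (- w) * pretzel_bracket n c A"

text \<open>Mahler measure of a function on the unit circle, given as a function of
theta, t = exp(2 pi i theta).\<close>

definition mahler_measure_circle :: "(real \<Rightarrow> complex) \<Rightarrow> real" where
  "mahler_measure_circle f = exp (integral {0..1} (\<lambda>\<theta>. ln (cmod (f \<theta>))))"

text \<open>M(V(t)): at t = exp(2 pi i theta) we take A = exp(-2 pi i theta / 4);
the modulus |V(t)| does not depend on the branch of t^(1/4).\<close>

definition pretzel_jones_mahler :: "int \<Rightarrow> nat \<Rightarrow> nat \<Rightarrow> real" where
  "pretzel_jones_mahler w n c =
     mahler_measure_circle (\<lambda>\<theta>. pretzel_jones_A w n c (cis (- (pi * \<theta> / 2))))"

end

theory Submission
  imports Defs "HOL-Complex_Analysis.Conformal_Mappings"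
    "HOL-Computational_Algebra.Fundamental_Theorem_Algebra"
begin

text \<open>
  A twist region with at least one A-smoothing is the horizontal smoothing together with some closed
  loops, and otherwise it is the vertical one. Counting loops turns the state sum into the closed form
  \<open>d \<langle>D\<rangle> = X\<^sup>n + (d\<^sup>2 - 1) Y\<^sup>n\<close>, so that on the unit circle \<open>\<bar>V\<bar> = \<bar>P\<^sub>n(s)\<bar> / \<bar>1 + s\<bar>\<^sup>n\<^sup>+\<^sup>1\<close> with
  \<open>s = A\<^sup>4\<close> and the monic polynomial \<open>P\<^sub>n = s N\<^sup>n + Q D\<^sup>n\<close>, where \<open>N = s\<^sup>c\<^sup>+\<^sup>1 - s\<^sup>2 - s - 1\<close>,
  \<open>D = s\<^sup>c\<^sup>+\<^sup>1 + s\<close>, \<open>Q = s\<^sup>2 + s + 1\<close>. By Jensen's formula the Mahler measure is the product of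
  \<open>max 1 \<bar>\<alpha>\<bar>\<close> over the roots \<open>\<alpha>\<close> of \<open>P\<^sub>n\<close>. The roots solve \<open>(N/D)\<^sup>n = - Q/s\<close> and hence accumulate along
  the curve \<open>\<bar>N\<bar> = \<bar>D\<bar>\<close>. This curve enters the region \<open>\<bar>s\<bar> > 1\<close>, because \<open>\<bar>N\<bar> > \<bar>D\<bar>\<close> at \<open>cis (\<pi>/c)\<close> and
  \<open>\<bar>N\<bar> < \<bar>D\<bar>\<close> at \<open>cis (2\<pi>/c)\<close>; so for some \<open>R > 1\<close> the number of roots of modulus at least \<open>R\<close> tends
  to infinity with \<open>n\<close>.
\<close>

section \<open>Loops of a Kauffman state\<close>

text \<open>Loops are classes of a relation on all triples. A function that separates exactly the
  classes met by \<open>E\<close> descends to a bijection, so a complete invariant suffices to count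
  them.\<close>

lemma card_quotient_eq_card_image:
  assumes "equiv UNIV r"
    and "\<And>x y. x \<in> E \<Longrightarrow> y \<in> E \<Longrightarrow> (x, y) \<in> r \<longleftrightarrow> f x = f y"
  shows "card (E // r) = card (f ` E)"
proof -
  have eq: "r `` {x} = r `` {y} \<longleftrightarrow> f x = f y" if "x \<in> E" "y \<in> E" for x y
    using eq_equiv_class_iff[OF assms(1), of x y] assms(2)[OF that] by simp
  define g where "g X = f (SOME x. x \<in> E \<and> r `` {x} = X)" for X
  have g: "g (r `` {x}) = f x" if "x \<in> E" for x
  proof -
    have "\<exists>y. y \<in> E \<and> r `` {y} = r `` {x}"
      using that by blast
    from someI_ex[OF this] show ?thesis
      unfolding g_def using eq that by blast
  qed
  have "E // r = (\<lambda>x. r `` {x}) ` E"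
    by (auto simp: quotient_def)
  moreover have "inj_on g ((\<lambda>x. r `` {x}) ` E)"
  proof (rule inj_onI)
    fix X Y assume "X \<in> (\<lambda>x. r `` {x}) ` E" "Y \<in> (\<lambda>x. r `` {x}) ` E" "g X = g Y"
    then show "X = Y"
      by (elim imageE) (simp add: g eq)
  qed
  moreover have "g ` (\<lambda>x. r `` {x}) ` E = f ` E"
    by (auto simp: g image_image)
  ultimately show ?thesis
    by (metis card_image)
qed

text \<open>A discrete intermediate value theorem; it shows later that every admissible label is
  attained.\<close>

lemma unit_steps_hit_all_values:
  fixes f :: "nat \<Rightarrow> nat"
  assumes "f 0 = 0" "\<And>l. f (Suc l) \<le> Suc (f l)" "m \<le> f L"
  shows "\<exists>l\<le>L. f l = m"
  using assms(3)
proof (induction L)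
  case 0
  then show ?case using assms(1) by auto
next
  case (Suc L)
  then show ?case
    using assms(2)[of L] by (metis le_SucE le_Suc_eq le_antisym order_trans order_refl)
qed

section \<open>The graph of a fixed state and its counting functions\<close>

locale pretzel_state =
  fixes n c :: nat and S :: "(nat \<times> nat) set"
  assumes n_pos: "n > 0" and c_pos: "c > 0" and S_sub: "S \<subseteq> pretzel_crossings n c"
begin

definition edges where
  "edges = pretzel_arcs n c \<union> pretzel_smoothing n c S"

definition conn (infix "\<sim>" 50) where
  "x \<sim> y \<longleftrightarrow> (x, y) \<in> (edges \<union> edges\<inverse>)\<^sup>*"

lemma equiv_conn: "equiv UNIV ((edges \<union> edges\<inverse>)\<^sup>*)"
  by (auto intro!: equivI simp: refl_on_def sym_rtrancl sym_Un_converse trans_rtrancl)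

lemma conn_refl [simp]: "x \<sim> x"
  by (simp add: conn_def)

lemma conn_sym: "x \<sim> y \<Longrightarrow> y \<sim> x"
  unfolding conn_def by (meson equiv_conn equivE symD)

lemma conn_trans [trans]: "x \<sim> y \<Longrightarrow> y \<sim> z \<Longrightarrow> x \<sim> z"
  unfolding conn_def by (rule rtrancl_trans)

lemma conn_edge: "(x, y) \<in> edges \<Longrightarrow> x \<sim> y"
  unfolding conn_def by auto

text \<open>\<open>cnt i l\<close> counts the A-smoothings above level \<open>l\<close> of region \<open>i\<close>; level \<open>l\<close> lies just
  above crossing \<open>l\<close>, so that levels run from \<open>0\<close> to \<open>c\<close>.\<close>

definition cnt :: "nat \<Rightarrow> nat \<Rightarrow> nat" where
  "cnt i l = card {j. j < l \<and> (i, j) \<in> S}"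

text \<open>The purely vertical regions: two strands run through from top to bottom, while in every
  other region an A-smoothing cuts the top off from the bottom.\<close>

definition Z :: "nat set" where
  "Z = {i. i < n \<and> cnt i c = 0}"

text \<open>Numbers the gaps between consecutive vertical regions; in the cyclic diagram the values
  0 and \<open>card Z\<close> name the same gap.\<close>

definition zc :: "nat \<Rightarrow> nat" where
  "zc x = card {z \<in> Z. z < x}"

lemma cnt_0 [simp]: "cnt i 0 = 0"
  by (simp add: cnt_def)

lemma cnt_Suc: "cnt i (Suc l) = (if (i, l) \<in> S then Suc (cnt i l) else cnt i l)"
proof -
  have "{j. j < Suc l \<and> (i, j) \<in> S} =
      (if (i, l) \<in> S then insert l {j. j < l \<and> (i, j) \<in> S} else {j. j < l \<and> (i, j) \<in> S})"
    by (auto simp: less_Suc_eq)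
  then show ?thesis
    by (simp add: cnt_def)
qed

lemma cnt_mono: "l \<le> m \<Longrightarrow> cnt i l \<le> cnt i m"
  unfolding cnt_def by (rule card_mono) auto

lemma finite_Z [simp]: "finite Z"
  by (simp add: Z_def)

lemma zc_0 [simp]: "zc 0 = 0"
  by (simp add: zc_def)

lemma zc_n [simp]: "zc n = card Z"
  unfolding zc_def by (rule arg_cong[of _ _ card]) (auto simp: Z_def)

lemma zc_Suc: "zc (Suc x) = (if x \<in> Z then Suc (zc x) else zc x)"
proof -
  have "{z \<in> Z. z < Suc x} = (if x \<in> Z then insert x {z \<in> Z. z < x} else {z \<in> Z. z < x})"
    by (auto simp: less_Suc_eq)
  then show ?thesis
    by (simp add: zc_def)
qed

lemma zc_mono: "x \<le> y \<Longrightarrow> zc x \<le> zc y"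
  unfolding zc_def by (rule card_mono) auto

section \<open>Connections inside a twist region and along the outer arcs\<close>

definition pt :: "nat \<Rightarrow> nat \<Rightarrow> nat \<Rightarrow> nat \<times> nat \<times> nat" where
  "pt i l s = (if l < c then (i, l, s) else (i, c - 1, s + 2))"

text \<open>\<open>p div 2\<close> is 0 at the top and 1 at the bottom of a crossing and
  \<open>p mod 2\<close> is the side, so \<open>j + p div 2\<close> is the level of the endpoint.
  \<open>pt\<close> picks the top of the next crossing, or a bottom endpoint at level
  \<open>c\<close>, where no crossing follows.\<close>

lemma endpoint_conn_pt:
  assumes "i < n" "j < c" "p < 4"
  shows "(i, j, p) \<sim> pt i (j + p div 2) (p mod 2)"
proof -
  consider "p < 2" | "p \<ge> 2" "Suc j = c" | "p = 2" "Suc j < c" | "p = 3" "Suc j < c"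
    using assms by linarith
  then show ?thesis
  proof cases
    case 2
    then have "p = 2 \<or> p = 3" using assms by auto
    moreover have "j = c - 1" using 2 by simp
    moreover have "pt i (j + p div 2) (p mod 2) = (i, c - 1, p)"
      using calculation c_pos by (auto simp: pt_def)
    ultimately show ?thesis by simp
  qed (use assms in \<open>auto simp: pt_def edges_def pretzel_arcs_def intro!: conn_edge\<close>)
qed

lemma crossing_conn:
  assumes "i < n" "j < c" "s < 2"
  shows "(i, j) \<notin> S \<Longrightarrow> pt i j s \<sim> pt i (Suc j) s"
    and "(i, j) \<in> S \<Longrightarrow> pt i j 0 \<sim> pt i j 1"
    and "(i, j) \<in> S \<Longrightarrow> pt i (Suc j) 0 \<sim> pt i (Suc j) 1"
proof -
  have s: "s = 0 \<or> s = 1" using assms by auto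
  have down: "(i, j, t + 2) \<sim> pt i (Suc j) t" if "t < 2" for t
    using endpoint_conn_pt[of i j "t + 2"] assms that by simp
  show "pt i j s \<sim> pt i (Suc j) s" if "(i, j) \<notin> S"
  proof -
    have "pt i j s \<sim> (i, j, s + 2)"
      using that s assms
      by (auto simp: pt_def edges_def pretzel_smoothing_def pretzel_crossings_def intro!: conn_edge)
    also have "\<dots> \<sim> pt i (Suc j) s"
      by (rule down) fact
    finally show ?thesis .
  qed
  show "pt i j 0 \<sim> pt i j 1" if "(i, j) \<in> S"
    using that assms by (auto simp: pt_def edges_def pretzel_smoothing_def intro!: conn_edge)
  show "pt i (Suc j) 0 \<sim> pt i (Suc j) 1" if "(i, j) \<in> S"
  proof -
    have "pt i (Suc j) 0 \<sim> (i, j, 2)"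
      using down[of 0] by (simp add: conn_sym numeral_2_eq_2)
    also have "\<dots> \<sim> (i, j, 3)"
      using that by (auto simp: edges_def pretzel_smoothing_def intro!: conn_edge)
    also have "\<dots> \<sim> pt i (Suc j) 1"
      using down[of 1] by (simp add: numeral_3_eq_3)
    finally show ?thesis .
  qed
qed

text \<open>Equal counts leave no A-smoothing between the two levels, so the strand runs straight
  down.\<close>

lemma block_conn:
  assumes "i < n" "s < 2" "l \<le> m" "m \<le> c" "cnt i l = cnt i m"
  shows "pt i l s \<sim> pt i m s"
  using assms(3-5)
proof (induction m rule: dec_induct)
  case (step m)
  have "cnt i l \<le> cnt i m"
    using step by (intro cnt_mono) auto
  then have "(i, m) \<notin> S" "cnt i l = cnt i m"
    using step by (auto simp: cnt_Suc split: if_splits)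
  then show ?case
    using step crossing_conn(1)[of i m s] assms conn_trans by (meson Suc_le_lessD less_imp_le_nat)
qed auto

text \<open>The levels with a common count form a block bounded by A-smoothings. As the region has
  one, at least one end of the block is capped, and the cap joins the left strand to the right
  one.\<close>

lemma level_conn:
  assumes "i < n" "s < 2" "s' < 2" "l \<le> c" "m \<le> c" "cnt i l = cnt i m" "cnt i c > 0"
  shows "pt i l s \<sim> pt i m s'"
proof -
  have LR: "pt i l 0 \<sim> pt i l 1"
  proof -
    have "\<exists>l'\<le>c. cnt i l' = cnt i l \<and> pt i l' 0 \<sim> pt i l' 1"
    proof (cases "cnt i l = 0")
      case True
      \<comment> \<open>This block starts at the top of the region, so its cap is the upper arc of
        the first A-smoothing.\<close>
      have "\<exists>x\<le>c. cnt i x = 1"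
        using assms(7) by (intro unit_steps_hit_all_values) (auto simp: cnt_Suc)
      then obtain x where x: "x \<le> c" "cnt i x = 1" by blast
      define y where "y = (LEAST x. cnt i x = 1)"
      have y: "cnt i y = 1" "y \<le> c"
        using x unfolding y_def by (auto intro: LeastI Least_le order_trans)
      then obtain y' where y': "y = Suc y'" by (cases y) auto
      have "cnt i y' \<noteq> 1"
        using not_less_Least[of y' "\<lambda>x. cnt i x = 1"] y' unfolding y_def by auto
      then have "(i, y') \<in> S" "cnt i y' = 0"
        using y y' by (auto simp: cnt_Suc split: if_splits)
      then show ?thesis
        using True y y' crossing_conn(2)[of i y' 0] assms by (intro exI[of _ y']) auto
    next
      case False
      \<comment> \<open>The first level of the block lies directly below an A-smoothing, whose lower
        arc is the cap.\<close>
      define y where "y = (LEAST x. cnt i x = cnt i l)"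
      have y: "cnt i y = cnt i l" "y \<le> l"
        unfolding y_def by (auto intro: LeastI Least_le)
      then obtain y' where y': "y = Suc y'" using False by (cases y) auto
      have "cnt i y' \<noteq> cnt i l"
        using not_less_Least[of y' "\<lambda>x. cnt i x = cnt i l"] y' unfolding y_def by auto
      then have "(i, y') \<in> S"
        using y y' by (auto simp: cnt_Suc split: if_splits)
      then show ?thesis
        using y y' crossing_conn(3)[of i y' 0] assms by (intro exI[of _ y]) auto
    qed
    then obtain l' where l': "l' \<le> c" "cnt i l' = cnt i l" "pt i l' 0 \<sim> pt i l' 1"
      by blast
    have "pt i l' t \<sim> pt i l t" if "t < 2" for t
      using block_conn[of i t l l'] block_conn[of i t l' l] l' assms that conn_sym
      by (metis nat_le_linear)
    then show ?thesis
      using conn_trans[OF conn_sym conn_trans[OF l'(3)]] by simp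
  qed
  have "pt i l s' \<sim> pt i m s'"
    using block_conn[of i s' l m] block_conn[of i s' m l] assms conn_sym
    by (metis nat_le_linear)
  moreover have "pt i l s \<sim> pt i l s'"
    using LR assms(2,3) by (auto simp: less_2_cases_iff conn_sym)
  ultimately show ?thesis
    using conn_trans by blast
qed

text \<open>\<open>T x\<close> and \<open>B x\<close> represent the outer arcs at the top and at the bottom between the regions
  \<open>x - 1\<close> and \<open>x\<close>, where the positions \<open>0\<close> and \<open>n\<close> coincide.\<close>

definition T :: "nat \<Rightarrow> nat \<times> nat \<times> nat" where "T x = pt (x mod n) 0 0"
definition B :: "nat \<Rightarrow> nat \<times> nat \<times> nat" where "B x = pt (x mod n) c 0"

text \<open>The left side of region \<open>i\<close> faces position \<open>i\<close> and its right
  side faces position \<open>i + 1\<close>, whence \<open>i + s\<close>.\<close>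

lemma outer_conn:
  assumes "i < n" "s < 2"
  shows "pt i 0 s \<sim> T (i + s)" "pt i c s \<sim> B (i + s)"
proof -
  have s: "s = 0 \<or> s = 1" using assms by auto
  have "pt i 0 1 \<sim> T (Suc i)" "pt i c 1 \<sim> B (Suc i)"
    using assms c_pos
    by (auto simp: T_def B_def pt_def edges_def pretzel_arcs_def numeral_3_eq_3 intro!: conn_edge)
  then show "pt i 0 s \<sim> T (i + s)" "pt i c s \<sim> B (i + s)"
    using s assms by (auto simp: T_def B_def)
qed

lemma region_conn:
  assumes "i < n"
  shows "i \<notin> Z \<Longrightarrow> T i \<sim> T (Suc i)" "i \<notin> Z \<Longrightarrow> B i \<sim> B (Suc i)"
    and "i \<in> Z \<Longrightarrow> T i \<sim> B i" "i \<in> Z \<Longrightarrow> T (Suc i) \<sim> B (Suc i)"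
proof -
  note T0 = outer_conn(1)[of i 0, simplified, OF assms]
  note T1 = outer_conn(1)[of i 1, simplified, OF assms]
  note B0 = outer_conn(2)[of i 0, simplified, OF assms]
  note B1 = outer_conn(2)[of i 1, simplified, OF assms]
  show "T i \<sim> T (Suc i)" "B i \<sim> B (Suc i)" if "i \<notin> Z"
  proof -
    have pos: "cnt i c > 0" using that assms by (auto simp: Z_def)
    have "pt i 0 0 \<sim> pt i 0 1" "pt i c 0 \<sim> pt i c 1"
      using assms pos by (auto intro!: level_conn)
    then show "T i \<sim> T (Suc i)" "B i \<sim> B (Suc i)"
      using conn_trans[OF conn_sym[OF T0] conn_trans[OF _ T1]]
        conn_trans[OF conn_sym[OF B0] conn_trans[OF _ B1]] by auto
  qed
  show "T i \<sim> B i" "T (Suc i) \<sim> B (Suc i)" if "i \<in> Z"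
  proof -
    have "pt i 0 0 \<sim> pt i c 0" "pt i 0 1 \<sim> pt i c 1"
      using that by (auto intro!: block_conn simp: Z_def)
    then show "T i \<sim> B i" "T (Suc i) \<sim> B (Suc i)"
      using conn_trans[OF conn_sym[OF T0] conn_trans[OF _ B0]]
        conn_trans[OF conn_sym[OF T1] conn_trans[OF _ B1]] by auto
  qed
qed

lemma outer_conn_no_zero:
  assumes "Z = {}" "x \<le> n"
  shows "T x \<sim> T 0" "B x \<sim> B 0"
proof -
  have "T x \<sim> T 0 \<and> B x \<sim> B 0"
    using assms(2)
  proof (induction x)
    case (Suc x)
    then show ?case
      using region_conn(1,2)[of x] assms(1) by (metis Suc_le_lessD conn_sym conn_trans empty_iff less_imp_le)
  qed auto
  then show "T x \<sim> T 0" "B x \<sim> B 0" by auto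
qed

text \<open>The connection passes across any region in both directions: a vertical region joins top
  to bottom on both of its sides, and any other region joins the two tops and the two
  bottoms.\<close>

lemma top_conn_bottom:
  assumes "Z \<noteq> {}" "x \<le> n"
  shows "T x \<sim> B x"
proof -
  have step: "T x \<sim> B x \<longleftrightarrow> T (Suc x) \<sim> B (Suc x)" if "x < n" for x
    using region_conn[OF that] by (meson conn_trans conn_sym)
  obtain z where z: "z \<in> Z" using assms by blast
  have "T z \<sim> B z" "z \<le> n"
    using z region_conn(3)[of z] by (auto simp: Z_def)
  \<comment> \<open>First descend from \<open>z\<close> to position 0, then climb to
    \<open>x\<close>.\<close>
  then have "T 0 \<sim> B 0"
    by (induction z) (auto simp: step)
  then show ?thesis
    using assms(2) by (induction x) (auto simp: step)
qed

text \<open>Inside a gap no region is vertical, so the tops are joined along it; the remainder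
  accounts for the identification of position \<open>n\<close> with 0.\<close>

lemma top_conn_top:
  assumes "x \<le> n" "y \<le> n" "zc x mod card Z = zc y mod card Z"
  shows "T x \<sim> T y"
proof -
  have eq: "T x \<sim> T y" if "x \<le> y" "y \<le> n" "zc x = zc y" for x y
    using that
  proof (induction y rule: dec_induct)
    case (step y)
    have "zc x \<le> zc y" using step by (intro zc_mono) auto
    then have "y \<notin> Z" "zc x = zc y"
      using step by (auto simp: zc_Suc split: if_splits)
    then show ?case
      using step region_conn(1)[of y] conn_trans by (meson Suc_le_lessD less_imp_le_nat)
  qed auto
  have eq': "T x \<sim> T y" if "x \<le> n" "y \<le> n" "zc x = zc y" for x y
    using eq[of x y] eq[of y x] that by (metis conn_sym nat_le_linear)
  have Tn: "T n = T 0" by (simp add: T_def)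
  have wrap: "T x \<sim> T y" if "x \<le> n" "y \<le> n" "zc x = 0" "zc y = card Z" for x y
    using eq'[of x 0] eq'[of n y] that Tn by (metis conn_trans order_refl zc_0 zc_n le0)
  have "zc x \<le> card Z" "zc y \<le> card Z"
    using zc_mono[of x n] zc_mono[of y n] assms by auto
  then have "zc x = zc y \<or> zc x = 0 \<and> zc y = card Z \<or> zc y = 0 \<and> zc x = card Z"
    using assms(3) by (metis le_neq_implies_less mod_less mod_self)
  then show ?thesis
    using eq' wrap assms conn_sym by blast
qed

text \<open>A complete invariant of the loops. Tag 0: the loop of region \<open>i\<close> enclosed
  between its \<open>k\<close>-th and its next A-smoothing. Tag 1: if no region is vertical, the top
  circle and the bottom circle. Tag 2: the loop in a gap between vertical regions, indexed
  cyclically.\<close>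

fun label :: "nat \<times> nat \<times> nat \<Rightarrow> nat \<times> nat \<times> nat" where
  "label (i, j, p) =
     (let k = cnt i (j + p div 2) in
      if 0 < k \<and> k < cnt i c then (0, i, k)
      else if Z = {} then (1, if k = 0 then 0 else 1, 0)
      else (2, zc (i + p mod 2) mod card Z, 0))"

lemma label_edge:
  assumes "(x, y) \<in> edges"
  shows "label x = label y"
proof -
  have c1: "c - Suc 0 + 1 = c" "Suc (c - Suc 0) = c" using c_pos by auto
  have wrap: "zc (Suc i) mod card Z = zc (Suc i mod n) mod card Z" if "i < n" for i
    using that by (cases "Suc i = n") auto
  \<comment> \<open>An A-smoothing joins the two sides of its region; as that region is not
    vertical, both sides lie in the same gap.\<close>
  have A: "zc (Suc i) = zc i" if "(i, j) \<in> S" for i j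
  proof -
    have "j < c" using S_sub that by (auto simp: pretzel_crossings_def)
    then have "cnt i c > 0"
      using cnt_mono[of "Suc j" c i] that by (auto simp: cnt_Suc)
    then show ?thesis by (simp add: Z_def zc_Suc)
  qed
  show ?thesis
    using assms unfolding edges_def pretzel_arcs_def pretzel_smoothing_def
  proof (elim UnE CollectE exE conjE)
    fix i assume i: "(x, y) = ((i, 0, 1), (Suc i mod n, 0, 0))" "i < n"
    then show ?thesis using wrap by auto
  next
    fix i assume i: "(x, y) = ((i, c - 1, 3), (Suc i mod n, c - 1, 2))" "i < n"
    have "Suc i mod n < n" using n_pos by simp
    \<comment> \<open>Without vertical regions the count at the bottom level is positive, which
      tells the bottom circle from the top one.\<close>
    then have "cnt i c \<noteq> 0 \<and> cnt (Suc i mod n) c \<noteq> 0" if "Z = {}"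
      using that i by (auto simp: Z_def)
    then show ?thesis
      using i wrap[of i] c1 by (auto simp: Let_def)
  qed (auto simp: cnt_Suc Let_def A)
qed

lemma conn_imp_label_eq:
  assumes "x \<sim> y"
  shows "label x = label y"
  using assms unfolding conn_def
proof (induction rule: rtrancl_induct)
  case (step y z)
  then have "label y = label z"
    using label_edge[of y z] label_edge[of z y] by (metis UnE converseD)
  then show ?case using step by metis
qed simp

lemma endpoint_conn_outer:
  assumes "i < n" "j < c" "p < 4" "\<not> (0 < cnt i (j + p div 2) \<and> cnt i (j + p div 2) < cnt i c)"
  shows "(i, j, p) \<sim> (if cnt i (j + p div 2) = 0 then T (i + p mod 2) else B (i + p mod 2))"
proof -
  let ?l = "j + p div 2" and ?s = "p mod 2"
  have l: "?l \<le> c" using assms by linarith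
  have s: "?s < 2" by simp
  note e = endpoint_conn_pt[OF assms(1-3)]
  show ?thesis
  proof (cases "cnt i ?l = 0")
    case True
    have "pt i 0 ?s \<sim> pt i ?l ?s"
      using assms l s True by (intro block_conn) auto
    then show ?thesis
      using True conn_trans[OF e conn_trans[OF conn_sym outer_conn(1)[OF assms(1) s]]] by simp
  next
    case False
    then have "cnt i ?l = cnt i c"
      using assms(4) cnt_mono[OF l, of i] by linarith
    then have "pt i ?l ?s \<sim> pt i c ?s"
      using assms l s by (intro block_conn) auto
    then show ?thesis
      using False conn_trans[OF e conn_trans[OF _ outer_conn(2)[OF assms(1) s]]] by simp
  qed
qed

lemma label_eq_imp_conn:
  assumes x: "x \<in> pretzel_endpoints n c" and y: "y \<in> pretzel_endpoints n c"
    and eq: "label x = label y"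
  shows "x \<sim> y"
proof -
  obtain i j p where x': "x = (i, j, p)" "i < n" "j < c" "p < 4"
    using x by (auto simp: pretzel_endpoints_def)
  obtain i' j' p' where y': "y = (i', j', p')" "i' < n" "j' < c" "p' < 4"
    using y by (auto simp: pretzel_endpoints_def)
  let ?l = "j + p div 2" and ?s = "p mod 2" and ?l' = "j' + p' div 2" and ?s' = "p' mod 2"
  let ?k = "cnt i ?l" and ?k' = "cnt i' ?l'"
  have l: "?l \<le> c" "?l' \<le> c" using x' y' by linarith+
  show ?thesis
  proof (cases "0 < ?k \<and> ?k < cnt i c")
    case True
    then have *: "i' = i" "?k' = ?k"
      using eq x' y' by (auto simp: Let_def split: if_splits)
    have "pt i ?l ?s \<sim> pt i ?l' ?s'"
      using True * x' l by (intro level_conn) auto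
    then show ?thesis
      using endpoint_conn_pt[OF x'(2-4)] endpoint_conn_pt[OF y'(2-4)] x'(1) y'(1) *
      by (metis conn_sym conn_trans)
  next
    case False
    then have False': "\<not> (0 < ?k' \<and> ?k' < cnt i' c)"
      using eq x' y' by (auto simp: Let_def split: if_splits)
    have ox: "x \<sim> (if ?k = 0 then T (i + ?s) else B (i + ?s))"
      unfolding x'(1) using endpoint_conn_outer[OF x'(2-4) False] .
    have oy: "y \<sim> (if ?k' = 0 then T (i' + ?s') else B (i' + ?s'))"
      unfolding y'(1) using endpoint_conn_outer[OF y'(2-4) False'] .
    have bd: "i + ?s \<le> n" "i' + ?s' \<le> n" using x' y' by linarith+
    show ?thesis
    proof (cases "Z = {}")
      case True
      then have "?k = 0 \<longleftrightarrow> ?k' = 0"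
        using eq x'(1) y'(1) False False' by (auto simp: Let_def split: if_splits)
      then consider "x \<sim> T (i + ?s)" "y \<sim> T (i' + ?s')" | "x \<sim> B (i + ?s)" "y \<sim> B (i' + ?s')"
        using ox oy by (cases "?k = 0") auto
      then have "\<exists>z. x \<sim> z \<and> y \<sim> z"
        by cases (meson outer_conn_no_zero[OF True] bd conn_trans)+
      then show ?thesis
        by (blast intro: conn_trans[OF _ conn_sym])
    next
      case Z: False
      then have "zc (i + ?s) mod card Z = zc (i' + ?s') mod card Z"
        using eq x'(1) y'(1) False False' by (auto simp: Let_def)
      then have "T (i + ?s) \<sim> T (i' + ?s')"
        using bd by (intro top_conn_top) auto
      moreover have "x \<sim> T (i + ?s)" "y \<sim> T (i' + ?s')"
        using ox oy conn_trans[OF _ conn_sym[OF top_conn_bottom[OF Z bd(1)]]]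
          conn_trans[OF _ conn_sym[OF top_conn_bottom[OF Z bd(2)]]]
        by (auto split: if_splits)
      ultimately show ?thesis
        using conn_trans[OF _ conn_trans[OF _ conn_sym]] by blast
    qed
  qed
qed

lemma level_endpoint:
  assumes "i < n" "l \<le> c" "s < 2"
  obtains j p where "(i, j, p) \<in> pretzel_endpoints n c" "j + p div 2 = l" "p mod 2 = s"
proof (cases "l < c")
  case True
  then show ?thesis
    using assms that[of l s] by (auto simp: pretzel_endpoints_def)
next
  case False
  then show ?thesis
    using assms that[of "c - 1" "s + 2"] c_pos by (auto simp: pretzel_endpoints_def)
qed

lemma label_image:
  "label ` pretzel_endpoints n c =
     {0} \<times> (SIGMA i:{..<n}. {0<..<cnt i c}) \<union>
     (if Z = {} then {(1, 0, 0), (1, 1, 0)} else (\<lambda>m. (2, m, 0)) ` {..<card Z})"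
  (is "?L = ?I \<union> ?O")
proof (intro equalityI subsetI)
  fix v assume "v \<in> ?L"
  then obtain i j p where "v = label (i, j, p)" "i < n"
    by (auto simp: pretzel_endpoints_def)
  then show "v \<in> ?I \<union> ?O"
    by (auto simp: Let_def card_gt_0_iff)
next
  fix v assume "v \<in> ?I \<union> ?O"
  then consider i k where "v = (0, i, k)" "i < n" "0 < k" "k < cnt i c"
    | "Z = {}" "v = (1, 0, 0)" | "Z = {}" "v = (1, 1, 0)"
    | m where "Z \<noteq> {}" "v = (2, m, 0)" "m < card Z"
    by (auto split: if_splits)
  then show "v \<in> ?L"
  proof cases
    case (1 i k)
    have "\<exists>l\<le>c. cnt i l = k"
      using 1 by (intro unit_steps_hit_all_values) (auto simp: cnt_Suc)
    then obtain l where l: "l \<le> c" "cnt i l = k" by blast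
    obtain j p where "(i, j, p) \<in> pretzel_endpoints n c" "j + p div 2 = l" "p mod 2 = 0"
      using level_endpoint[of i l 0] 1 l by auto
    then show ?thesis
      using 1 l by (intro image_eqI[of _ _ "(i, j, p)"]) auto
  next
    case 2
    obtain j p where "(0, j, p) \<in> pretzel_endpoints n c" "j + p div 2 = 0" "p mod 2 = 0"
      using level_endpoint[of 0 0 0] n_pos by auto
    then show ?thesis
      using 2 by (intro image_eqI[of _ _ "(0, j, p)"]) auto
  next
    case 3
    obtain j p where "(0, j, p) \<in> pretzel_endpoints n c" "j + p div 2 = c" "p mod 2 = 0"
      using level_endpoint[of 0 c 0] n_pos by auto
    moreover have "cnt 0 c \<noteq> 0"
      using 3 n_pos by (auto simp: Z_def)
    ultimately show ?thesis
      using 3 by (intro image_eqI[of _ _ "(0, j, p)"]) auto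
  next
    case (4 m)
    have "\<exists>x\<le>n. zc x = m"
      using 4 by (intro unit_steps_hit_all_values) (auto simp: zc_Suc)
    then obtain x where x: "x \<le> n" "zc x = m" by blast
    \<comment> \<open>\<open>zc n = card Z\<close> exceeds \<open>m\<close>, so \<open>x\<close> is
      the index of an actual region.\<close>
    then have "x < n"
      using 4 by (metis le_neq_implies_less nat_neq_iff zc_n)
    then obtain j p where "(x, j, p) \<in> pretzel_endpoints n c" "j + p div 2 = 0" "p mod 2 = 0"
      using level_endpoint[of x 0 0] by auto
    then show ?thesis
      using 4 x by (intro image_eqI[of _ _ "(x, j, p)"]) auto
  qed
qed

text \<open>A region with a > 0 A-smoothings encloses a - 1 loops, and truncated subtraction gives 0
  for vertical regions. The second summand counts the loops through the outer arcs.\<close>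

lemma loops_eq:
  "pretzel_loops n c S =
     (\<Sum>i<n. cnt i c - 1) + (if Z = {} then 2 else card Z)"
proof -
  have "pretzel_loops n c S = card (label ` pretzel_endpoints n c)"
    unfolding pretzel_loops_def Let_def edges_def[symmetric]
    using conn_imp_label_eq label_eq_imp_conn unfolding conn_def
    by (intro card_quotient_eq_card_image[OF equiv_conn]) blast
  also have "\<dots> = card ({0::nat} \<times> (SIGMA i:{..<n}. {0<..<cnt i c})) +
      card (if Z = {} then {(1, 0, 0), (1, 1, 0)} else (\<lambda>m. (2::nat, m, 0::nat)) ` {..<card Z})"
    unfolding label_image by (rule card_Un_disjoint) auto
  also have "card ({0::nat} \<times> (SIGMA i:{..<n}. {0<..<cnt i c})) = (\<Sum>i<n. cnt i c - 1)"
    by (simp add: card_cartesian_product)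
  also have "card (if Z = {} then {(1, 0, 0), (1, 1, 0)} else (\<lambda>m. (2::nat, m, 0::nat)) ` {..<card Z})
      = (if Z = {} then 2 else card Z)"
    by (auto simp: card_image inj_on_def)
  finally show ?thesis .
qed

end

section \<open>The Kauffman bracket\<close>

context pretzel_state
begin

lemma finite_S: "finite S"
  using S_sub finite_subset by (fastforce simp: pretzel_crossings_def)

lemma cnt_c: "cnt i c = card (S `` {i})"
  unfolding cnt_def by (rule arg_cong[of _ _ card]) (use S_sub in \<open>auto simp: pretzel_crossings_def\<close>)

lemma card_S: "card S = (\<Sum>i<n. cnt i c)"
proof -
  have "S = (SIGMA i:{..<n}. S `` {i})"
    using S_sub by (auto simp: pretzel_crossings_def)
  moreover have "card (SIGMA i:{..<n}. S `` {i}) = (\<Sum>i<n. card (S `` {i}))"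
    using finite_S by (intro card_SigmaI) auto
  ultimately show ?thesis
    by (simp add: cnt_c)
qed

lemma card_compl_S: "card (pretzel_crossings n c - S) + card S = n * c"
  using card_Diff_subset[OF finite_S S_sub] card_mono[OF _ S_sub]
  by (auto simp: pretzel_crossings_def)

text \<open>The first product is what the loop count of the case \<open>Z \<noteq> {}\<close> would give for every state;
  the second one vanishes unless \<open>Z = {}\<close>, when it corrects \<open>d\<^sup>0\<close> to \<open>d\<^sup>2\<close>.\<close>

lemma state_term:
  fixes A d :: complex
  assumes "A \<noteq> 0"
  shows "A powi (int (card S) - int (card (pretzel_crossings n c - S)))
           * d ^ (pretzel_loops n c S - 1) * d * A ^ (n * c) =
     (\<Prod>i<n. A ^ (2 * card (S `` {i})) * (if S `` {i} = {} then d else d ^ (card (S `` {i}) - 1))) +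
     (d\<^sup>2 - 1) *
       (\<Prod>i<n. A ^ (2 * card (S `` {i})) * (if S `` {i} = {} then 0 else d ^ (card (S `` {i}) - 1)))"
proof -
  have fin: "finite (S `` {i})" for i
    using finite_S by auto
  have emp: "S `` {i} = {} \<longleftrightarrow> cnt i c = 0" for i
    using fin by (simp add: cnt_c)
  \<comment> \<open>The exponent is a - b with a + b = \<open>n * c\<close>; adding
    \<open>n * c\<close> leaves 2 a and clears the negative powers.\<close>
  have "A powi (int (card S) - int (card (pretzel_crossings n c - S))) * A ^ (n * c)
      = A powi (int (card S) - int (card (pretzel_crossings n c - S)) + int (n * c))"
    using assms by (subst power_int_add) (auto simp: power_int_of_nat simp del: of_nat_mult)
  also have "int (card S) - int (card (pretzel_crossings n c - S)) + int (n * c) = int (2 * card S)"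
    using card_compl_S by linarith
  also have "A powi int (2 * card S) = A ^ (2 * card S)"
    by (rule power_int_of_nat)
  finally have A: "A powi (int (card S) - int (card (pretzel_crossings n c - S))) * A ^ (n * c)
      = A ^ (2 * card S)" .
  have loops: "pretzel_loops n c S > 0"
    by (auto simp: loops_eq card_gt_0_iff)
  have pA: "A ^ (2 * card S) = (\<Prod>i<n. A ^ (2 * cnt i c))"
    by (simp add: card_S power_sum sum_distrib_left)
  have main: "d ^ pretzel_loops n c S =
      (\<Prod>i<n. if cnt i c = 0 then d else d ^ (cnt i c - 1)) +
      (d\<^sup>2 - 1) * (\<Prod>i<n. if cnt i c = 0 then 0 else d ^ (cnt i c - 1))"
  proof (cases "Z = {}")
    case True
    then have nz: "cnt i c \<noteq> 0" if "i < n" for i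
      using that by (auto simp: Z_def)
    have "(\<Prod>i<n. if cnt i c = 0 then d else d ^ (cnt i c - 1)) = (\<Prod>i<n. d ^ (cnt i c - 1))"
      "(\<Prod>i<n. if cnt i c = 0 then 0 else d ^ (cnt i c - 1)) = (\<Prod>i<n. d ^ (cnt i c - 1))"
      by (intro prod.cong refl; simp add: nz)+
    then show ?thesis
      using True by (simp add: loops_eq power_add power_sum algebra_simps power2_eq_square)
  next
    case False
    then obtain z where "z < n" "cnt z c = 0"
      by (auto simp: Z_def)
    then have "(\<Prod>i<n. if cnt i c = 0 then 0 else d ^ (cnt i c - 1)) = 0"
      by (intro prod_zero bexI[of _ z]) auto
    moreover have "(\<Prod>i<n. if cnt i c = 0 then d else d ^ (cnt i c - 1)) =
        (\<Prod>i<n. d ^ (cnt i c - 1) * (if i \<in> Z then d else 1))"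
      by (auto intro!: prod.cong simp: Z_def)
    moreover have "(\<Prod>i<n. if i \<in> Z then d else 1) = d ^ card Z"
    proof -
      have "{..<n} \<inter> Z = Z" by (auto simp: Z_def)
      then show ?thesis
        by (simp add: prod.If_cases Collect_mem_eq)
    qed
    ultimately show ?thesis
      using False by (simp add: loops_eq power_add power_sum prod.distrib)
  qed
  have "A powi (int (card S) - int (card (pretzel_crossings n c - S)))
           * d ^ (pretzel_loops n c S - 1) * d * A ^ (n * c) =
      A ^ (2 * card S) * d ^ pretzel_loops n c S"
    unfolding A[symmetric] using loops by (simp add: power_eq_if ac_simps)
  also have "\<dots> = (\<Prod>i<n. A ^ (2 * cnt i c) * (if cnt i c = 0 then d else d ^ (cnt i c - 1))) +
     (d\<^sup>2 - 1) * (\<Prod>i<n. A ^ (2 * cnt i c) * (if cnt i c = 0 then 0 else d ^ (cnt i c - 1)))"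
    unfolding main pA prod.distrib by (simp add: algebra_simps)
  finally show ?thesis
    by (simp only: emp cnt_c[symmetric])
qed

end

section \<open>Summation over all states\<close>

lemma sum_Pow_power_card:
  fixes x :: "'a :: comm_semiring_1"
  assumes "finite C"
  shows "(\<Sum>T\<in>Pow C. x ^ card T) = (1 + x) ^ card C"
  using prod_add[OF assms, of "\<lambda>_. x" "\<lambda>_. 1"] by (simp add: add.commute)

text \<open>A state is an independent choice of a subset of \<open>C\<close> in each region, so
  distributivity turns the sum of products into a power.\<close>

lemma sum_Pow_Times_prod:
  fixes f :: "'b set \<Rightarrow> 'c :: comm_semiring_1"
  assumes "finite I" "finite C"
  shows "(\<Sum>S\<in>Pow (I \<times> C). \<Prod>i\<in>I. f (S `` {i})) = (\<Sum>T\<in>Pow C. f T) ^ card I"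
proof -
  have "(\<Sum>S\<in>Pow (I \<times> C). \<Prod>i\<in>I. f (S `` {i})) = (\<Sum>g\<in>PiE I (\<lambda>_. Pow C). \<Prod>i\<in>I. f (g i))"
    by (rule sum.reindex_bij_witness[of _ "\<lambda>g. Sigma I g" "\<lambda>S. \<lambda>i\<in>I. S `` {i}"])
      (auto simp: PiE_iff extensional_def fun_eq_iff restrict_def Image_def intro!: prod.cong)
  also have "\<dots> = (\<Sum>T\<in>Pow C. f T) ^ card I"
    using assms by (subst prod_sum_PiE[symmetric]) auto
  finally show ?thesis .
qed

text \<open>By \<open>state_term\<close> the bracket reduces to \<open>n\<close>-th powers of sums
  over one region. One factor \<open>d\<close> restores the loop count lowered by 1, the other
  \<open>n\<close> complete \<open>d ^ (card T - 1)\<close> in each region; oddness of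
  \<open>c\<close> fixes the sign of \<open>A ^ (4 * c)\<close>.\<close>

lemma bracket_closed_form:
  fixes A :: complex
  assumes "n > 0" "odd c" "A \<noteq> 0" and d: "d = - (A\<^sup>2) - inverse (A\<^sup>2)"
  shows "pretzel_bracket n c A * A ^ (n * c) * d ^ Suc n =
           (d\<^sup>2 - 1 - A ^ (4 * c)) ^ n + (d\<^sup>2 - 1) * (- 1 - A ^ (4 * c)) ^ n"
proof -
  let ?C = "{0..<c}" and ?X = "pretzel_crossings n c"
  let ?w = "\<lambda>T. A ^ (2 * card T) * (if T = {} then d else d ^ (card T - 1))"
  let ?e = "\<lambda>T. A ^ (2 * card T) * (if T = {} then 0 else d ^ (card T - 1))"
  have c: "c > 0" using assms(2) by (auto intro: Nat.gr0I)
  have fin: "finite T" if "T \<in> Pow ?C" for T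
    using that finite_subset by auto
  have e: "d * (\<Sum>T\<in>Pow ?C. ?e T) = - 1 - A ^ (4 * c)"
  proof -
    have s1: "(\<Sum>T\<in>Pow ?C. (A\<^sup>2 * d) ^ card T) = 1 + d * (\<Sum>T\<in>Pow ?C. ?e T)"
    proof -
      \<comment> \<open>Extracting a factor \<open>d\<close> fails only for the empty set, whose
        term is 1 whereas \<open>?e\<close> vanishes there.\<close>
      have "(\<Sum>T\<in>Pow ?C. (A\<^sup>2 * d) ^ card T) = (\<Sum>T\<in>Pow ?C. d * ?e T + (if T = {} then 1 else 0))"
      proof (rule sum.cong[OF refl])
        fix T assume T: "T \<in> Pow ?C"
        show "(A\<^sup>2 * d) ^ card T = d * ?e T + (if T = {} then 1 else 0)"
        proof (cases "T = {}")
          case False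
          then have "card T > 0" using fin[OF T] by (simp add: card_gt_0_iff)
          then have "d ^ card T = d * d ^ (card T - 1)"
            by (simp add: power_eq_if)
          then show ?thesis
            using False by (simp add: power_mult_distrib power_mult[symmetric])
        qed auto
      qed
      also have "\<dots> = 1 + d * (\<Sum>T\<in>Pow ?C. ?e T)"
        by (simp add: sum.distrib sum_distrib_left sum.delta)
      finally show ?thesis .
    qed
    have s2: "(\<Sum>T\<in>Pow ?C. (A\<^sup>2 * d) ^ card T) = (1 + A\<^sup>2 * d) ^ c"
      by (simp add: sum_Pow_power_card)
    have s3: "1 + A\<^sup>2 * d = - (A ^ 4)"
      using assms(3) by (simp add: d field_simps power2_eq_square power4_eq_xxxx)
    have s4: "(- (A ^ 4)) ^ c = - (A ^ (4 * c))"
      using assms(2) by (simp add: power_minus_odd power_mult)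
    have "x = - 1 - z" if "1 + x = - z" for x z :: complex
      using that by (metis add_diff_cancel_left' minus_diff_commute)
    then show ?thesis
      using s1[symmetric] unfolding s2 s3 s4 by blast
  qed
  have w: "d * (\<Sum>T\<in>Pow ?C. ?w T) = d\<^sup>2 - 1 - A ^ (4 * c)"
  proof -
    have "(\<Sum>T\<in>Pow ?C. ?w T) = (\<Sum>T\<in>Pow ?C. ?e T + (if T = {} then d else 0))"
      by (intro sum.cong) auto
    also have "\<dots> = (\<Sum>T\<in>Pow ?C. ?e T) + d"
      by (simp add: sum.distrib sum.delta)
    finally show ?thesis
      using e by (simp add: algebra_simps power2_eq_square)
  qed
  have "pretzel_bracket n c A * d * A ^ (n * c) =
      (\<Sum>S\<in>Pow ?X. (\<Prod>i<n. ?w (S `` {i})) + (d\<^sup>2 - 1) * (\<Prod>i<n. ?e (S `` {i})))"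
    unfolding pretzel_bracket_def sum_distrib_right d[symmetric]
  proof (rule sum.cong[OF refl])
    fix S assume "S \<in> Pow ?X"
    then interpret pretzel_state n c S
      using assms(1) c by unfold_locales auto
    show "A powi (int (card S) - int (card (?X - S))) * d ^ (pretzel_loops n c S - 1) * d * A ^ (n * c)
        = (\<Prod>i<n. ?w (S `` {i})) + (d\<^sup>2 - 1) * (\<Prod>i<n. ?e (S `` {i}))"
      using state_term[OF assms(3)] .
  qed
  also have "\<dots> = (\<Sum>T\<in>Pow ?C. ?w T) ^ n + (d\<^sup>2 - 1) * (\<Sum>T\<in>Pow ?C. ?e T) ^ n"
    unfolding pretzel_crossings_def sum.distrib sum_distrib_left[symmetric] atLeast0LessThan
    using sum_Pow_Times_prod[of "{..<n}" "{..<c}" ?w] sum_Pow_Times_prod[of "{..<n}" "{..<c}" ?e]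
    by simp
  finally have sum: "pretzel_bracket n c A * d * A ^ (n * c) =
      (\<Sum>T\<in>Pow ?C. ?w T) ^ n + (d\<^sup>2 - 1) * (\<Sum>T\<in>Pow ?C. ?e T) ^ n" .
  have "(X ^ n + q * Y ^ n) * d ^ n = (d * X) ^ n + q * (d * Y) ^ n" for X Y q :: complex
    by (simp add: power_mult_distrib algebra_simps)
  then have "pretzel_bracket n c A * d * A ^ (n * c) * d ^ n =
      (d * (\<Sum>T\<in>Pow ?C. ?w T)) ^ n + (d\<^sup>2 - 1) * (d * (\<Sum>T\<in>Pow ?C. ?e T)) ^ n"
    unfolding sum .
  then show ?thesis
    unfolding e w by (simp add: ac_simps)
qed

section \<open>Jensen's formula for polynomials\<close>

lemma has_integral_periodic_shift:
  fixes f :: "real \<Rightarrow> real"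
  assumes per: "\<And>x. f (x + 1) = f x" and f: "(f has_integral I) {0..1}" and a: "0 \<le> a" "a \<le> 1"
  shows "((\<lambda>x. f (x + a)) has_integral I) {0..1}"
proof -
  have int: "f integrable_on {0..a}" "f integrable_on {a..1}"
    using f a by (auto intro: integrable_subinterval_real[OF has_integral_integrable[OF f]])
  have "((\<lambda>x. f (1 *\<^sub>R x + a)) has_integral integral {a..1} f /\<^sub>R 1 ^ DIM(real))
      (cbox ((a - a) /\<^sub>R 1) ((1 - a) /\<^sub>R 1))"
    by (rule has_integral_affinity') (use int in \<open>auto simp: has_integral_integral\<close>)
  then have 1: "((\<lambda>x. f (x + a)) has_integral integral {a..1} f) {0..1 - a}"
    by simp
  have "((\<lambda>x. f (1 *\<^sub>R x + (a - 1))) has_integral integral {0..a} f /\<^sub>R 1 ^ DIM(real))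
      (cbox ((0 - (a - 1)) /\<^sub>R 1) ((a - (a - 1)) /\<^sub>R 1))"
    by (rule has_integral_affinity') (use int in \<open>auto simp: has_integral_integral\<close>)
  moreover have "f (x + (a - 1)) = f (x + a)" for x
    using per[of "x + (a - 1)"] by (simp add: algebra_simps)
  ultimately have 2: "((\<lambda>x. f (x + a)) has_integral integral {0..a} f) {1 - a..1}"
    by simp
  have "integral {a..1} f + integral {0..a} f = I"
    using Henstock_Kurzweil_Integration.integral_combine[OF a, of f] f
    by (simp add: has_integral_iff add.commute)
  then show ?thesis
    using has_integral_combine[OF _ _ 1 2] a by simp
qed

lemma has_integral_periodic_double:
  fixes f :: "real \<Rightarrow> real"
  assumes per: "\<And>x. f (x + 1) = f x" and f: "(f has_integral I) {0..1}"
  shows "((\<lambda>x. f (2 * x)) has_integral I) {0..1}"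
proof -
  have f': "(f has_integral I) (cbox 0 1)"
    using f by simp
  have 1: "((\<lambda>x. f (2 * x)) has_integral I / 2) {0..1/2}"
    using has_integral_affinity'[OF f', of 2 0] by (simp add: inverse_eq_divide)
  have "((\<lambda>x. f (2 * x - 1)) has_integral I / 2) {1/2..1}"
    using has_integral_affinity'[OF f', of 2 "-1"] by (simp add: inverse_eq_divide)
  moreover have "f (2 * x - 1) = f (2 * x)" for x
    using per[of "2 * x - 1"] by simp
  ultimately have 2: "((\<lambda>x. f (2 * x)) has_integral I / 2) {1/2..1}"
    by (simp only:)
  show ?thesis
    using has_integral_combine[OF _ _ 1 2] by simp
qed

text \<open>In sin y = 2 sin(y/2) cos(y/2) the cosine is at least cos(pi/4), and by the mean value
  theorem sin(y/2) is at least (y/2) cos(pi/4); the two cosines multiply to 1/2.\<close>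

lemma half_le_sin:
  assumes "0 \<le> y" "y \<le> pi / 2"
  shows "y / 2 \<le> sin (y::real)"
proof (cases "y = 0")
  case False
  then have y: "0 < y / 2" "y / 2 \<le> pi / 4" using assms by auto
  have cos4: "cos (pi / 4) \<le> cos x" if "0 \<le> x" "x \<le> pi / 4" for x
    using that pi_gt_zero by (intro cos_monotone_0_pi_le) auto
  obtain z where z: "0 < z" "z < y / 2" "sin (y / 2) - sin 0 = (y / 2 - 0) * cos z"
    using MVT2[OF y(1), of sin cos] by (auto intro: DERIV_sin)
  have "y / 2 * cos (pi / 4) \<le> sin (y / 2)"
    using cos4[of z] z y by (auto intro!: mult_left_mono)
  then have "2 * (y / 2 * cos (pi / 4)) * cos (pi / 4) \<le> 2 * sin (y / 2) * cos (y / 2)"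
    using cos4[of "y / 2"] y by (intro mult_mono) (auto simp: cos_45 sin_ge_zero)
  also have "\<dots> = sin y"
    using sin_double[of "y / 2"] by simp
  also have "2 * (y / 2 * cos (pi / 4)) * cos (pi / 4) = y / 2"
    by (simp add: cos_45)
  finally show ?thesis .
qed auto

lemma cmod_1_minus_cis: "cmod (1 - cis (2 * t)) = 2 * \<bar>sin t\<bar>"
proof -
  have "1 - cis (2 * t) = - 2 * \<i> * of_real (sin t) * cis t"
    by (simp add: complex_eq_iff cos_double_sin sin_double power2_eq_square)
  then show ?thesis
    by (simp add: norm_mult)
qed

text \<open>The lower bound is a product so that its logarithm splits into one singular term for
  each end of the interval.\<close>

lemma cmod_1_minus_cis_ge:
  assumes "0 \<le> x" "x \<le> 1"
  shows "x * (1 - x) \<le> cmod (1 - cis (2 * pi * x))"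
proof -
  have *: "x * (1 - x) \<le> 2 * sin (pi * x)" if "0 \<le> x" "x \<le> 1 / 2" for x :: real
  proof -
    have "pi * x / 2 \<le> sin (pi * x)"
      using that by (intro half_le_sin) auto
    moreover have "x * (1 - x) \<le> x * pi"
      using that pi_gt3 by (intro mult_left_mono) auto
    ultimately show ?thesis by (simp add: mult.commute)
  qed
  have "x * (1 - x) \<le> 2 * sin (pi * x)"
  proof (cases "x \<le> 1 / 2")
    case False
    have "sin (pi * (1 - x)) = sin (pi * x)"
      by (simp add: right_diff_distrib sin_diff)
    then show ?thesis using *[of "1 - x"] False assms by (simp add: mult.commute)
  qed (use * assms in auto)
  also have "\<dots> \<le> 2 * \<bar>sin (pi * x)\<bar>" by simp
  also have "\<dots> = cmod (1 - cis (2 * pi * x))"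
    using cmod_1_minus_cis[of "pi * x"] by (simp add: mult.assoc)
  finally show ?thesis .
qed

section \<open>The integral of log |1 - b s| over the unit circle\<close>

definition lnc :: "complex \<Rightarrow> real \<Rightarrow> real" where
  "lnc b x = ln (cmod (1 - b * cis (2 * pi * x)))"

lemma cis_periodic: "cis (2 * pi * (x + 1)) = cis (2 * pi * x)"
  by (simp add: cis_mult[symmetric] ring_distribs)

lemma lnc_periodic: "lnc b (x + 1) = lnc b x"
  by (simp only: lnc_def cis_periodic)

lemma inj_on_cis_circle: "inj_on (\<lambda>x. cis (2 * pi * x)) {0..<1}"
proof (rule inj_onI)
  fix x y :: real assume xy: "x \<in> {0..<1}" "y \<in> {0..<1}" "cis (2 * pi * x) = cis (2 * pi * y)"
  then have "sin (2 * pi * x) = sin (2 * pi * y) \<and> cos (2 * pi * x) = cos (2 * pi * y)"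
    by (simp add: complex_eq_iff)
  then obtain m :: int where "2 * pi * x = 2 * pi * y + 2 * pi * m"
    unfolding sin_cos_eq_iff by blast
  then have "2 * pi * x = 2 * pi * (y + m)"
    by (simp add: algebra_simps)
  then have "x = y + m"
    by simp
  then show "x = y"
    using xy by auto
qed

text \<open>The logarithmic identities below hold off the zeros of their arguments; this makes the
  exceptional points negligible for the integral.\<close>

lemma finite_circle_preimage:
  assumes "finite F"
  shows "finite {x \<in> {0..1}. cis (2 * pi * x) \<in> F}"
proof -
  have "{x \<in> {0..1}. cis (2 * pi * x) \<in> F} \<subseteq> insert 1 ((\<lambda>x. cis (2 * pi * x)) -` F \<inter> {0..<1})"
    by auto
  then show ?thesis
    using finite_vimage_IntI[OF assms inj_on_cis_circle] finite_subset by blast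
qed

text \<open>The logarithmic singularities at both ends are dominated by inverse square roots, which
  are integrable.\<close>

lemma lnc_1_integrable: "lnc 1 integrable_on {0..1}"
proof -
  let ?g = "\<lambda>x::real. ln 2 + 2 * x powr (- (1/2)) + 2 * (1 - x) powr (- (1/2))"
  have p: "((\<lambda>x::real. x powr (- (1/2))) has_integral 2) (cbox 0 1)"
    using has_integral_powr_from_0[of "- (1/2)" 1] by simp
  then have "((\<lambda>x::real. (1 - x) powr (- (1/2))) has_integral 2) {0..1}"
    using has_integral_affinity[OF p, of "-1" 1] by simp
  then have g: "?g integrable_on {0..1}"
    using p by (intro integrable_add integrable_on_cmult_left) (auto simp: has_integral_iff)
  have meas: "lnc 1 \<in> borel_measurable (lebesgue_on {0..1})"
  proof -
    have "(\<lambda>x. cmod (1 - 1 * cis (2 * pi * x))) \<in> borel_measurable borel"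
      by (intro borel_measurable_continuous_onI continuous_intros)
    then have "lnc 1 \<in> borel_measurable borel"
      unfolding lnc_def by measurable
    then show ?thesis
      by (simp add: measurable_completion measurable_restrict_space1)
  qed
  \<comment> \<open>This is ln y <= 2 sqrt y at y = 1 / x.\<close>
  have neg_ln: "- ln x \<le> 2 * x powr (- (1/2))" if "0 < x" "x \<le> 1" for x :: real
    using ln_powr_bound[of "1 / x" "1/2"] that
    by (simp add: ln_div powr_divide powr_minus_divide)
  have "\<bar>lnc 1 x\<bar> \<le> ?g x" if x: "x \<in> {0..1}" for x
  proof (cases "x = 0 \<or> x = 1")
    case True
    then show ?thesis by (auto simp: lnc_def)
  next
    case False
    then have x: "0 < x" "x < 1" using x by auto
    let ?y = "cmod (1 - cis (2 * pi * x))"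
    have y: "x * (1 - x) \<le> ?y"
      using x by (intro cmod_1_minus_cis_ge) auto
    have pos: "0 < x * (1 - x)" using x by simp
    have "?y \<le> 2"
      using norm_triangle_ineq4[of 1 "cis (2 * pi * x)"] by simp
    then have "ln ?y \<le> ln 2"
      using y pos by (intro ln_mono) auto
    moreover have "ln x + ln (1 - x) \<le> ln ?y"
      using x y pos ln_mult[of x "1 - x"] ln_mono[OF y] by simp
    moreover have "- ln x \<le> 2 * x powr (- (1/2))" "- ln (1 - x) \<le> 2 * (1 - x) powr (- (1/2))"
      using neg_ln x by auto
    moreover have "0 \<le> x powr (- (1/2))" "0 \<le> (1 - x) powr (- (1/2))" "0 \<le> ln (2::real)"
      by auto
    ultimately have "ln ?y \<le> ?g x" "- ln ?y \<le> ?g x"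
      by linarith+
    then show ?thesis
      by (simp add: lnc_def abs_le_iff)
  qed
  then show ?thesis
    by (intro measurable_bounded_by_integrable_imp_integrable_real[OF meas g]) auto
qed

lemma lnc_cis: "lnc (cis (2 * pi * a)) x = lnc 1 (x + a)"
  by (simp add: lnc_def cis_mult ring_distribs add.commute)

text \<open>Turning \<open>b\<close> along the circle shifts the argument of the periodic function
  \<open>lnc 1\<close>, so a single value serves for all \<open>b\<close>.\<close>

lemma lnc_has_integral_norm1:
  "\<exists>I. \<forall>b. cmod b = 1 \<longrightarrow> (lnc b has_integral I) {0..1}"
proof (intro exI allI impI)
  fix b :: complex assume b: "cmod b = 1"
  define a where "a = Arg2pi b / (2 * pi)"
  have "b = cis (2 * pi * a)"
    using b Arg2pi_eq[of b] by (simp add: a_def cis_conv_exp)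
  moreover have "0 \<le> a" "a \<le> 1"
    using Arg2pi_ge_0[of b] Arg2pi_lt_2pi[of b] by (auto simp: a_def)
  ultimately show "(lnc b has_integral (integral {0..1} (lnc 1))) {0..1}"
    using has_integral_periodic_shift[of "lnc 1" "integral {0..1} (lnc 1)" a] lnc_periodic[of 1]
      lnc_1_integrable lnc_cis[of a] by (simp add: has_integral_integral cong: has_integral_cong)
qed

text \<open>The modulus lies between 1 - |b| and 1 + |b|, and 1 + |b| <= 1 / (1 - |b|) makes the
  bound for the logarithm symmetric.\<close>

lemma lnc_continuous:
  assumes "cmod b < 1"
  shows "continuous_on {0..1} (lnc b)" "\<bar>lnc b x\<bar> \<le> - ln (1 - cmod b)"
proof -
  have lo: "1 - cmod b \<le> cmod (1 - b * cis (2 * pi * x))" for x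
    using norm_triangle_ineq2[of 1 "b * cis (2 * pi * x)"] by (simp add: norm_mult)
  have up: "cmod (1 - b * cis (2 * pi * x)) \<le> 1 + cmod b" for x
    using norm_triangle_ineq4[of 1 "b * cis (2 * pi * x)"] by (simp add: norm_mult)
  have pos: "0 < cmod (1 - b * cis (2 * pi * x))" for x
    using lo[of x] assms by linarith
  show "continuous_on {0..1} (lnc b)"
    unfolding lnc_def using pos
    by (intro continuous_intros continuous_on_ln) (auto simp: less_le)
  have "ln (1 - cmod b) \<le> lnc b x"
    unfolding lnc_def using lo[of x] assms by (intro ln_mono) auto
  moreover have "lnc b x \<le> - ln (1 - cmod b)"
  proof -
    have "1 + cmod b \<le> inverse (1 - cmod b)"
      using assms by (simp add: field_simps)
    then have "lnc b x \<le> ln (inverse (1 - cmod b))"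
      unfolding lnc_def using up[of x] pos[of x] by (intro ln_mono) auto
    then show ?thesis using assms by (simp add: ln_inverse)
  qed
  ultimately show "\<bar>lnc b x\<bar> \<le> - ln (1 - cmod b)" by linarith
qed

text \<open>In 1 - b^2 s^2 = (1 - b s)(1 + b s), squaring \<open>s\<close> doubles the angle and -s
  is \<open>s\<close> moved by half a period; neither change affects the integral.\<close>

lemma lnc_double:
  assumes f: "(lnc b has_integral I) {0..1}" and g: "(lnc (b\<^sup>2) has_integral J) {0..1}" and "b \<noteq> 0"
  shows "J = 2 * I"
proof -
  have half: "cis (2 * pi * (x + 1/2)) = - cis (2 * pi * x)" for x
    by (simp add: ring_distribs cis_mult[symmetric])
  have dbl: "cis (2 * pi * (2 * x)) = (cis (2 * pi * x))\<^sup>2" for x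
    by (simp add: power2_eq_square cis_mult)
  have int1: "((\<lambda>x. lnc b x + lnc b (x + 1/2)) has_integral I + I) {0..1}"
    using has_integral_periodic_shift[OF lnc_periodic f, of "1/2"] f by (intro has_integral_add) auto
  have int2: "((\<lambda>x. lnc (b\<^sup>2) (2 * x)) has_integral J) {0..1}"
    by (rule has_integral_periodic_double[OF lnc_periodic g])
  have eq: "lnc (b\<^sup>2) (2 * x) = lnc b x + lnc b (x + 1/2)"
    if "x \<in> {0..1} - {x \<in> {0..1}. cis (2 * pi * x) \<in> {1 / b, - 1 / b}}" for x
  proof -
    let ?s = "cis (2 * pi * x)"
    have nz: "1 - b * ?s \<noteq> 0" "1 + b * ?s \<noteq> 0"
      using that \<open>b \<noteq> 0\<close> by (auto simp: field_simps eq_neg_iff_add_eq_0)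
    have "1 - b\<^sup>2 * ?s\<^sup>2 = (1 - b * ?s) * (1 + b * ?s)"
      by (simp add: power2_eq_square algebra_simps)
    then have "lnc (b\<^sup>2) (2 * x) = ln (cmod (1 - b * ?s) * cmod (1 + b * ?s))"
      by (simp only: lnc_def dbl norm_mult)
    also have "\<dots> = ln (cmod (1 - b * ?s)) + ln (cmod (1 + b * ?s))"
      using nz by (intro ln_mult_pos) auto
    also have "\<dots> = lnc b x + lnc b (x + 1/2)"
      by (simp only: lnc_def half) simp
    finally show ?thesis .
  qed
  have "((\<lambda>x. lnc (b\<^sup>2) (2 * x)) has_integral I + I) {0..1}"
    by (rule has_integral_spike_finite[OF finite_circle_preimage[of "{1 / b, - 1 / b}"] eq int1]) auto
  then show ?thesis
    using has_integral_unique[OF int2] by simp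
qed

text \<open>The integral \<open>I(b)\<close> satisfies \<open>I(b\<^sup>2) = 2 I(b)\<close> and stays bounded along \<open>b, b\<^sup>2, b\<^sup>4, \<dots>\<close>.\<close>

lemma lnc_integral:
  assumes "cmod b \<le> 1"
  shows "(lnc b has_integral 0) {0..1}"
proof (cases "cmod b = 1")
  case True
  then obtain I where I: "\<And>b. cmod b = 1 \<Longrightarrow> (lnc b has_integral I) {0..1}"
    using lnc_has_integral_norm1 by blast
  \<comment> \<open>On the circle the integral does not depend on \<open>b\<close>, and 1 is its own
    square.\<close>
  have "I = 2 * I"
    using lnc_double[OF I[of 1] I[of "1\<^sup>2"]] by auto
  then show ?thesis using I[OF True] by simp
next
  case False
  then have b: "cmod b < 1" using assms by simp
  show ?thesis
  proof (cases "b = 0")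
    case True
    then have "lnc b = (\<lambda>_. 0)" by (auto simp: lnc_def)
    then show ?thesis by simp
  next
    case nz: False
    define I where "I b = integral {0..1} (lnc b)" for b
    have I: "(lnc b has_integral I b) {0..1}" if "cmod b < 1" for b
      unfolding I_def by (rule integrable_integral, rule integrable_continuous_interval)
        (rule lnc_continuous[OF that])
    have lt: "cmod (b ^ m) \<le> cmod b" if "m > 0" for m
      using b power_decreasing[of 1 m "cmod b"] that by (simp add: norm_power)
    have iter: "I (b ^ (2 ^ m)) = 2 ^ m * I b" for m
    proof (induction m)
      case (Suc m)
      have "cmod (b ^ (2 ^ m)) < 1" "cmod (b ^ (2 ^ Suc m)) < 1"
        using b lt[of "2 ^ m"] lt[of "2 ^ Suc m"] by auto
      then have "I (b ^ (2 ^ Suc m)) = 2 * I (b ^ (2 ^ m))"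
        using nz by (intro lnc_double[of "b ^ (2 ^ m)"])
          (auto intro!: I simp: power_mult[symmetric] mult.commute)
      then show ?case using Suc by simp
    qed simp
    have bound: "\<bar>I b'\<bar> \<le> - ln (1 - cmod b)" if "cmod b' \<le> cmod b" for b'
    proof -
      have b': "cmod b' < 1" using that b by simp
      have "norm (I b') \<le> - ln (1 - cmod b') * measure lborel (cbox 0 (1::real))"
        using lnc_continuous(2)[OF b'] b' I[OF b']
        by (intro has_integral_bound) (auto simp: ln_le_zero_iff)
      also have "\<dots> \<le> - ln (1 - cmod b)"
        using that b by simp
      finally show ?thesis by simp
    qed
    have "\<bar>I b\<bar> \<le> - ln (1 - cmod b) * (1/2) ^ m" for m
      using bound[OF lt[of "2 ^ m"]] unfolding iter
      by (simp add: abs_mult field_simps power_one_over)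
    moreover have "(\<lambda>m. - ln (1 - cmod b) * (1/2) ^ m) \<longlonglongrightarrow> - ln (1 - cmod b) * 0"
      by (intro tendsto_intros LIMSEQ_power_zero) auto
    ultimately have "\<bar>I b\<bar> \<le> - ln (1 - cmod b) * 0"
      by (intro LIMSEQ_le_const) auto
    then show ?thesis using I[OF b] by simp
  qed
qed

text \<open>For |a| <= 1 a unimodular factor is split off. Otherwise \<open>- a\<close> is split
  off, and conjugation replaces \<open>a\<close> by its inverse 1 / a, conjugated, inside the disc.
  The sign of the angle is that of \<open>A ^ 4\<close> in the definition of the measure.\<close>

lemma jensen_linear:
  "((\<lambda>x. ln (cmod (cis (- (2 * pi * x)) - a))) has_integral ln (max 1 (cmod a))) {0..1}"
proof (cases "cmod a \<le> 1")
  case True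
  have "cis (- (2 * pi * x)) - a = cis (- (2 * pi * x)) * (1 - a * cis (2 * pi * x))" for x
    by (simp add: algebra_simps cis_mult)
  then have "ln (cmod (cis (- (2 * pi * x)) - a)) = lnc a x" for x
    by (simp add: lnc_def norm_mult)
  then show ?thesis
    using lnc_integral[OF True] True by (simp add: max_def)
next
  case False
  then have a: "a \<noteq> 0" "cmod (cnj (1 / a)) < 1"
    by (auto simp: norm_divide divide_less_eq)
  have "ln (cmod (cis (- (2 * pi * x)) - a)) = lnc (cnj (1 / a)) x + ln (cmod a)" for x
  proof -
    have "cis (- (2 * pi * x)) - a = - a * cnj (1 - cnj (1 / a) * cis (2 * pi * x))"
      using a by (simp add: algebra_simps cis_cnj)
    then have "cmod (cis (- (2 * pi * x)) - a) =
        cmod a * cmod (1 - cnj (1 / a) * cis (2 * pi * x))"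
      by (simp only: norm_mult complex_mod_cnj norm_minus_cancel)
    moreover have "cmod (cnj (1 / a) * cis (2 * pi * x)) < 1"
      using a(2) by (simp only: norm_mult norm_cis mult_1_right)
    then have "cmod (1 - cnj (1 / a) * cis (2 * pi * x)) > 0"
      by (metis eq_iff_diff_eq_0 less_irrefl norm_one zero_less_norm_iff)
    then have "ln (cmod a * cmod (1 - cnj (1 / a) * cis (2 * pi * x))) =
        ln (cmod a) + lnc (cnj (1 / a)) x"
      unfolding lnc_def using a(1) by (intro ln_mult_pos) auto
    ultimately show ?thesis
      by (simp only: add.commute)
  qed
  moreover have "((\<lambda>x. lnc (cnj (1 / a)) x + ln (cmod a)) has_integral 0 + ln (cmod a)) {0..1}"
    by (rule has_integral_add[OF lnc_integral])
      (use a(2) has_integral_const_real[of "ln (cmod a)" 0 1] in simp_all)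
  moreover have "0 + ln (cmod a) = ln (max 1 (cmod a))"
    using False by (simp add: max_def)
  ultimately show ?thesis
    by (simp only:)
qed

lemma finite_circle_roots:
  fixes p :: "complex poly"
  assumes "p \<noteq> 0"
  shows "finite {x \<in> {0..1}. poly p (cis (- (2 * pi * x))) = 0}"
proof -
  have "finite (cnj ` {z. poly p z = 0})"
    using poly_roots_finite[OF assms] by simp
  from finite_circle_preimage[OF this] show ?thesis
    by (rule finite_subset[rotated]) (auto intro!: image_eqI simp: cis_cnj)
qed

text \<open>The factorization into linear factors reduces this to \<open>jensen_linear\<close>, off
  the finitely many roots on the circle.\<close>

lemma jensen_poly:
  fixes p :: "complex poly"
  assumes "lead_coeff p = 1"
  shows "((\<lambda>x. ln (cmod (poly p (cis (- (2 * pi * x)))))) has_integral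
     (\<Sum>z | poly p z = 0. of_nat (order z p) * ln (max 1 (cmod z)))) {0..1}"
proof -
  have nz: "p \<noteq> 0" using assms by auto
  note fin = poly_roots_finite[OF nz]
  have int: "((\<lambda>x. \<Sum>z | poly p z = 0. of_nat (order z p) * ln (cmod (cis (- (2 * pi * x)) - z)))
     has_integral (\<Sum>z | poly p z = 0. of_nat (order z p) * ln (max 1 (cmod z)))) {0..1}"
    using fin by (intro has_integral_sum has_integral_mult_right jensen_linear) auto
  have "ln (cmod (poly p s)) = (\<Sum>z | poly p z = 0. of_nat (order z p) * ln (cmod (s - z)))"
    if "poly p s \<noteq> 0" for s
  proof -
    have "poly p s = (\<Prod>z | poly p z = 0. (s - z) ^ order z p)"
      by (subst complex_poly_decompose[of p, symmetric]) (simp add: assms poly_prod)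
    then have "cmod (poly p s) = (\<Prod>z | poly p z = 0. cmod (s - z) ^ order z p)"
      by (simp add: prod_norm[symmetric] norm_power)
    also have "ln \<dots> = (\<Sum>z | poly p z = 0. ln (cmod (s - z) ^ order z p))"
      using fin that by (intro ln_prod) auto
    finally show ?thesis
      using that by (simp add: ln_realpow)
  qed
  then show ?thesis
    by (intro has_integral_spike_finite[OF finite_circle_roots[OF nz] _ int]) auto
qed

lemma jensen_poly_ge:
  fixes p :: "complex poly"
  assumes "lead_coeff p = 1" "R \<ge> 1" "F \<subseteq> {z. poly p z = 0 \<and> R \<le> cmod z}"
  shows "real (card F) * ln R \<le> (\<Sum>z | poly p z = 0. of_nat (order z p) * ln (max 1 (cmod z)))"
proof -
  have nz: "p \<noteq> 0" using assms by auto
  have fin: "finite {z. poly p z = 0}" by (rule poly_roots_finite[OF nz])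
  have "real (card F) * ln R = (\<Sum>z\<in>F. ln R)" by simp
  also have "\<dots> \<le> (\<Sum>z\<in>F. of_nat (order z p) * ln (max 1 (cmod z)))"
  proof (rule sum_mono)
    fix z assume "z \<in> F"
    then have z: "poly p z = 0" "R \<le> cmod z" using assms by auto
    then have "1 \<le> order z p" using nz by (simp add: order_root Suc_le_eq)
    moreover have "ln R \<le> ln (max 1 (cmod z))"
      using z assms(2) by (intro ln_mono) auto
    ultimately have "1 * ln R \<le> of_nat (order z p) * ln (max 1 (cmod z))"
      using assms(2) by (intro mult_mono) auto
    then show "ln R \<le> of_nat (order z p) * ln (max 1 (cmod z))" by simp
  qed
  also have "\<dots> \<le> (\<Sum>z | poly p z = 0. of_nat (order z p) * ln (max 1 (cmod z)))"
    using fin assms(3) by (intro sum_mono2) auto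
  finally show ?thesis .
qed

section \<open>Roots outside the unit disc\<close>

text \<open>Near a point where \<open>\<bar>z\<bar> = 1\<close> take \<open>z\<close> as the coordinate and write \<open>h = exp H\<close>: for each \<open>m\<close>,
  a solution is a fixed point of \<open>\<zeta> \<mapsto> exp ((H \<zeta> + 2 \<pi> \<i> m) / n)\<close>, up to the choice of branch.\<close>

lemma many_power_solutions:
  fixes z h :: "complex \<Rightarrow> complex"
  assumes U: "open U" "s0 \<in> U" and z: "z holomorphic_on U" "deriv z s0 \<noteq> 0" "cmod (z s0) = 1"
    and h: "continuous_on U h" "\<And>s. s \<in> U \<Longrightarrow> h s \<noteq> 0"
  shows "eventually (\<lambda>n. \<exists>F\<subseteq>U. card F = K \<and> (\<forall>s\<in>F. z s ^ n = h s)) sequentially"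
proof -
  define z0 where "z0 = z s0"
  have z0: "cmod z0 = 1" "z0 \<noteq> 0" using z(3) by (auto simp: z0_def)
  obtain r where r: "r > 0" "ball s0 r \<subseteq> U" "open (z ` ball s0 r)" "inj_on z (ball s0 r)"
    using has_complex_derivative_locally_invertible[OF z(1) U(2,1) z(2)] .
  have hol: "z holomorphic_on ball s0 r"
    using z(1) r(2) holomorphic_on_subset by blast
  obtain g where g: "g holomorphic_on (z ` ball s0 r)" "\<And>s. s \<in> ball s0 r \<Longrightarrow> g (z s) = s"
    by (rule holomorphic_has_inverse[OF hol open_ball r(4)]) (rule that, assumption, simp)
  have "z0 \<in> z ` ball s0 r" using r(1) by (auto simp: z0_def)
  then obtain \<rho> where \<rho>: "\<rho> > 0" "cball z0 \<rho> \<subseteq> z ` ball s0 r"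
    using r(3) open_contains_cball by blast
  have gU: "g w \<in> U" "z (g w) = w" if "w \<in> cball z0 \<rho>" for w
    using that \<rho>(2) g(2) r(2) by fastforce+
  have cont_g: "continuous_on (cball z0 \<rho>) g"
    using g(1) \<rho>(2) holomorphic_on_imp_continuous_on continuous_on_subset by blast
  have "continuous_on (cball z0 \<rho>) (\<lambda>w. h (g w))"
    using gU(1) by (intro continuous_on_compose2[OF h(1) cont_g]) auto
  then obtain H where H: "continuous_on (cball z0 \<rho>) H" "\<And>w. w \<in> cball z0 \<rho> \<Longrightarrow> h (g w) = exp (H w)"
    using continuous_logarithm_on_cball[of z0 \<rho> "\<lambda>w. h (g w)"] h(2) gU(1) by metis
  have "bounded (H ` cball z0 \<rho>)"
    by (rule compact_imp_bounded[OF compact_continuous_image[OF H(1) compact_cball]])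
  then obtain B where "\<forall>x\<in>H ` cball z0 \<rho>. cmod x \<le> B"
    unfolding bounded_iff by blast
  then have B: "cmod (H w) \<le> B" if "w \<in> cball z0 \<rho>" for w
    using that by blast
  \<comment> \<open>Bounds the numerator of the exponent \<open>e m w\<close> below:
    \<open>B\<close> for \<open>H\<close>, pi for the angle \<open>b\<close>, and the rest for the
    branch \<open>m < K\<close>.\<close>
  define C where "C = B + pi + 2 * pi * real K"
  have "isCont exp (0 :: complex)" by simp
  then obtain \<delta> where \<delta>: "\<delta> > 0" "\<And>w::complex. cmod w < \<delta> \<Longrightarrow> cmod (exp w - 1) < \<rho>"
    unfolding continuous_at_eps_delta using \<rho>(1) by (metis dist_norm diff_zero exp_zero)
  have "(\<lambda>n. C / real n) \<longlonglongrightarrow> 0"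
    by (rule lim_const_over_n)
  then have "eventually (\<lambda>n. C / real n < \<delta>) sequentially"
    using \<delta>(1) by (rule order_tendstoD)
  moreover have "eventually (\<lambda>n. n > 0 \<and> n \<ge> K) sequentially"
    using eventually_gt_at_top[of 0] eventually_ge_at_top[of K] by eventually_elim auto
  ultimately show ?thesis
  proof eventually_elim
    case (elim n)
    \<comment> \<open>\<open>b\<close> cancels the phase of \<open>z0 ^ n\<close>, so that a fixed
      point \<open>w\<close> satisfies \<open>w ^ n = exp (H w)\<close> exactly.\<close>
    define b where "b = Arg (inverse (z0 ^ n))"
    have b: "exp (\<i> * of_real b) = inverse (z0 ^ n)" "\<bar>b\<bar> \<le> pi"
      using Arg_eq[of "inverse (z0 ^ n)"] z0 mpi_less_Arg[of "inverse (z0 ^ n)"]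
        Arg_le_pi[of "inverse (z0 ^ n)"]
      by (auto simp: b_def norm_inverse norm_power)
    define e where "e m w = (H w + \<i> * of_real b + 2 * of_real pi * \<i> * of_nat m) / of_nat n" for m w
    have "\<exists>w\<in>cball z0 \<rho>. z0 * exp (e m w) = w" if "m < K" for m
    proof -
      \<comment> \<open>The exponent is at most \<open>C / n\<close> in modulus, so the exponential
        is close to 1 and the disc is mapped into itself, as Brouwer's theorem requires.\<close>
      have im: "z0 * exp (e m w) \<in> cball z0 \<rho>" if w: "w \<in> cball z0 \<rho>" for w
      proof -
        have "cmod (H w + \<i> * of_real b + 2 * of_real pi * \<i> * of_nat m) \<le>
            cmod (H w) + cmod (\<i> * of_real b) + cmod (2 * of_real pi * \<i> * of_nat m)"
          by (meson add_right_mono norm_triangle_ineq order_trans)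
        also have "\<dots> \<le> C"
          using B[OF w] b(2) \<open>m < K\<close> by (simp add: C_def norm_mult add_mono)
        finally have "cmod (e m w) \<le> C / real n"
          by (simp add: e_def norm_divide divide_right_mono)
        then have "cmod (exp (e m w) - 1) < \<rho>"
          using elim by (intro \<delta>(2)) auto
        moreover have "z0 * exp (e m w) - z0 = z0 * (exp (e m w) - 1)"
          by (simp add: algebra_simps)
        ultimately have "cmod (z0 * exp (e m w) - z0) < \<rho>"
          using z0(1) by (simp only: norm_mult mult_1)
        then show ?thesis
          by (simp add: dist_norm norm_minus_commute)
      qed
      have cont: "continuous_on (cball z0 \<rho>) (\<lambda>w. z0 * exp (e m w))"
        unfolding e_def using elim by (intro continuous_intros H(1)) auto
      show ?thesis
        by (rule brouwer[OF compact_cball convex_cball _ cont]) (use im \<rho>(1) in auto)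
    qed
    then obtain w where w: "\<And>m. m < K \<Longrightarrow> w m \<in> cball z0 \<rho>"
        "\<And>m. m < K \<Longrightarrow> z0 * exp (e m (w m)) = w m"
      by metis
    have "inj_on (\<lambda>m. g (w m)) {..<K}"
    proof (rule inj_onI)
      fix m m' assume m: "m \<in> {..<K}" "m' \<in> {..<K}" "g (w m) = g (w m')"
      then have "w m = w m'" using gU(2) w(1) by (metis lessThan_iff)
      then have "exp (e m (w m)) = exp (e m' (w m))"
        using w(2)[of m] w(2)[of m'] m z0(2) by (metis lessThan_iff mult_left_cancel)
      then obtain k :: int where k: "e m (w m) = e m' (w m) + of_int (2 * k) * of_real pi * \<i>"
        unfolding exp_eq by auto
      have "of_nat m * (2 * of_real pi * \<i>) = (of_nat m' + of_int k * of_nat n) * (2 * of_real pi * \<i>)"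
        using k elim unfolding e_def by (simp add: field_simps)
      then have "of_nat m = (of_nat m' + of_int k * of_nat n :: complex)"
        by simp
      then have "of_int (int m) = (of_int (int m' + k * int n) :: complex)"
        by simp
      then have mm: "int m = int m' + k * int n"
        by (simp only: of_int_eq_iff)
      \<comment> \<open>Equal solutions force the branches to differ by a multiple of
        \<open>n\<close>, and \<open>n \<ge> K\<close> leaves only 0.\<close>
      have "\<bar>int m - int m'\<bar> < int n" using m elim by auto
      then have "\<bar>k\<bar> * int n < 1 * int n" by (simp add: mm abs_mult)
      then have "k = 0" by (simp only: mult_less_cancel_right) auto
      then show "m = m'" using mm by simp
    qed
    then have "card ((\<lambda>m. g (w m)) ` {..<K}) = K"
      by (simp add: card_image)
    moreover have "z (g (w m)) ^ n = h (g (w m))" if "m < K" for m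
    proof -
      have "exp (of_nat n * e m (w m)) = exp (H (w m)) * exp (\<i> * of_real b)"
      proof -
        have "of_nat n * e m (w m) = H (w m) + \<i> * of_real b + 2 * of_real pi * \<i> * of_nat m"
          using elim by (simp add: e_def)
        moreover have "exp (2 * of_real pi * \<i> * of_nat m) = (1 :: complex)"
          using exp_eq_1[of "2 * of_real pi * \<i> * of_nat m"]
          by (auto intro!: exI[of _ "int m"])
        ultimately show ?thesis
          by (simp add: exp_add)
      qed
      then have "w m ^ n = z0 ^ n * (exp (H (w m)) * inverse (z0 ^ n))"
        using w(2)[OF that] b(1) by (metis exp_of_nat_mult power_mult_distrib)
      also have "\<dots> = h (g (w m))"
        using H(2)[OF w(1)[OF that]] z0(2) by simp
      finally show ?thesis
        using gU(2)[OF w(1)[OF that]] by simp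
    qed
    ultimately show ?case
      using gU(1) w(1) by (intro exI[of _ "(\<lambda>m. g (w m)) ` {..<K}"]) auto
  qed
qed

text \<open>With \<open>s = A\<^sup>4\<close> and \<open>d = - A\<^sup>2 - A\<^sup>-\<^sup>2\<close>, these are \<open>- s (d\<^sup>2 - 1 - s\<^sup>c)\<close>, \<open>s (1 + s\<^sup>c)\<close> and
  \<open>s (d\<^sup>2 - 1)\<close>, the ingredients of the closed form of the bracket cleared of denominators.\<close>

definition Npoly :: "nat \<Rightarrow> complex poly" where "Npoly c = monom 1 (Suc c) - [:1, 1, 1:]"
definition Dpoly :: "nat \<Rightarrow> complex poly" where "Dpoly c = monom 1 (Suc c) + [:0, 1:]"
definition Qpoly :: "complex poly" where "Qpoly = [:1, 1, 1:]"
definition Ppoly :: "nat \<Rightarrow> nat \<Rightarrow> complex poly" where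
  "Ppoly n c = [:0, 1:] * Npoly c ^ n + Qpoly * Dpoly c ^ n"

lemma poly_Npoly: "poly (Npoly c) s = s ^ Suc c - (1 + s + s\<^sup>2)"
  by (simp add: Npoly_def poly_monom power2_eq_square algebra_simps)

lemma poly_Dpoly: "poly (Dpoly c) s = s ^ Suc c + s"
  by (simp add: Dpoly_def poly_monom)

lemma poly_Qpoly: "poly Qpoly s = 1 + s + s\<^sup>2"
  by (simp add: Qpoly_def power2_eq_square algebra_simps)

lemma poly_Ppoly: "poly (Ppoly n c) s = s * poly (Npoly c) s ^ n + poly Qpoly s * poly (Dpoly c) s ^ n"
  by (simp add: Ppoly_def)

text \<open>The second summand is monic of degree \<open>2 + Suc c * n\<close>, which exceeds the
  degree of the first.\<close>

lemma lead_coeff_Ppoly: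
  assumes "c \<ge> 1"
  shows "lead_coeff (Ppoly n c) = 1"
proof -
  have degD: "degree (Dpoly c) = Suc c" and lcD: "lead_coeff (Dpoly c) = 1"
  proof -
    have lt: "degree [:0, 1::complex:] < degree (monom (1::complex) (Suc c))"
      using assms by (simp add: degree_monom_eq)
    show "degree (Dpoly c) = Suc c"
      unfolding Dpoly_def using degree_add_eq_left[OF lt] by (simp add: degree_monom_eq)
    then show "lead_coeff (Dpoly c) = 1"
      using assms by (simp add: Dpoly_def coeff_pCons split: nat.split)
  qed
  have D0: "Dpoly c \<noteq> 0" using lcD by auto
  have Q: "degree Qpoly = 2" "lead_coeff Qpoly = 1" "Qpoly \<noteq> 0"
    by (auto simp: Qpoly_def)
  have degN: "degree (Npoly c) \<le> Suc c"
    unfolding Npoly_def using assms by (intro degree_diff_le) (auto simp: degree_monom_eq)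
  have "degree ([:0, 1:] * Npoly c ^ n) \<le> 1 + Suc c * n"
    using degree_mult_le[of "[:0, 1:]" "Npoly c ^ n"] degree_power_le[of "Npoly c" n]
      mult_right_mono[OF degN, of n] by simp
  moreover have "degree (Qpoly * Dpoly c ^ n) = 2 + Suc c * n"
    using Q D0 by (simp add: degree_mult_eq degree_power_eq degD)
  ultimately have "lead_coeff (Ppoly n c) = lead_coeff (Qpoly * Dpoly c ^ n)"
    unfolding Ppoly_def by (intro lead_coeff_add_le) auto
  then show ?thesis
    by (simp only: lead_coeff_mult lead_coeff_power lcD Q(2) power_one mult_1)
qed

text \<open>Moving \<open>s1\<close> radially outwards leaves the closed disc; the nonempty open set
  reached is infinite, so it cannot lie in \<open>B\<close>.\<close>

lemma exists_outside_disc_near_circle: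
  fixes s1 :: complex
  assumes "open V" "s1 \<in> V" "cmod s1 = 1" "finite B"
  shows "\<exists>s\<in>V. cmod s > 1 \<and> s \<notin> B"
proof -
  obtain e where e: "e > 0" "ball s1 e \<subseteq> V" using assms openE by blast
  define s where "s = (1 + of_real (e / 2)) * s1"
  have "s - s1 = of_real (e / 2) * s1"
    by (simp add: s_def algebra_simps)
  then have "cmod (s - s1) = cmod (of_real (e / 2)) * cmod s1"
    by (simp only: norm_mult)
  then have "dist s1 s = e / 2"
    using e assms(3) by (simp add: dist_norm norm_minus_commute)
  then have "s \<in> V" using e by auto
  have "1 + of_real (e / 2) = (of_real (1 + e / 2) :: complex)" by simp
  then have "cmod s = 1 + e / 2"
    unfolding s_def using e assms(3) by (simp only: norm_mult norm_of_real) simp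
  then have "s \<in> V \<inter> - cball 0 1" using e \<open>s \<in> V\<close> by simp
  moreover have "open (V \<inter> - cball 0 1)" using assms(1) by (intro open_Int) auto
  ultimately have "infinite (V \<inter> - cball 0 1)"
    using finite_imp_not_open by blast
  then have "\<not> V \<inter> - cball 0 1 \<subseteq> B"
    using assms(4) finite_subset by blast
  then show ?thesis by auto
qed

text \<open>\<open>f\<close> takes both signs on the unit circle, hence also outside the disc. The
  exterior stays connected when the finite set \<open>Bad\<close> is deleted, so \<open>f\<close>
  has a zero there, at which the other conditions hold automatically.\<close>

lemma exists_crossing_outside_disc:
  assumes "c \<ge> 3"
  shows "\<exists>s. cmod s > 1 \<and> cmod (poly (Npoly c) s) = cmod (poly (Dpoly c) s) \<and>
     poly (Dpoly c) s \<noteq> 0 \<and> poly Qpoly s \<noteq> 0 \<and>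
     poly (pderiv (Npoly c) * Dpoly c - Npoly c * pderiv (Dpoly c)) s \<noteq> 0"
proof -
  define W where "W = pderiv (Npoly c) * Dpoly c - Npoly c * pderiv (Dpoly c)"
  define f where "f s = cmod (poly (Npoly c) s) - cmod (poly (Dpoly c) s)" for s
  define Bad where "Bad = {s. poly (Dpoly c * Qpoly * W) s = 0}"
  \<comment> \<open>\<open>W\<close> is the numerator of the derivative of N/D; one nonzero value
    makes its root set finite.\<close>
  have "poly W 0 = 1"
    using assms by (simp add: W_def Npoly_def Dpoly_def pderiv_diff pderiv_add pderiv_monom
        poly_monom pderiv_pCons power_0_left)
  then have "W \<noteq> 0" by auto
  moreover have "Dpoly c \<noteq> 0" "Qpoly \<noteq> 0"
    using poly_Dpoly[of c 1] poly_Qpoly[of 1] by auto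
  ultimately have fin: "finite Bad"
    unfolding Bad_def by (intro poly_roots_finite) simp
  have cont: "continuous_on UNIV f"
    unfolding f_def by (intro continuous_intros)
  have c0: "real c > 0" using assms by simp
  let ?s1 = "cis (pi / c)" and ?s2 = "cis (2 * pi / c)"
  have "f ?s1 > 0"
  proof -
    have "?s1 ^ c = cis (real c * (pi / c))" by (rule Complex.DeMoivre)
    also have "real c * (pi / c) = pi" using c0 by simp
    finally have p: "?s1 ^ c = - 1" by simp
    have "poly (Npoly c) ?s1 = - ((1 + ?s1)\<^sup>2)" "poly (Dpoly c) ?s1 = 0"
      unfolding poly_Npoly poly_Dpoly power_Suc p by (auto simp: power2_eq_square algebra_simps)
    moreover have "1 + ?s1 \<noteq> 0"
    proof -
      have "sin (pi / c) > 0" using assms by (intro sin_gt_zero) (auto simp: field_simps)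
      then show ?thesis by (auto simp: complex_eq_iff)
    qed
    ultimately show ?thesis by (simp add: f_def)
  qed
  moreover have "f ?s2 < 0"
  proof -
    have "?s2 ^ c = cis (real c * (2 * pi / c))" by (rule Complex.DeMoivre)
    also have "real c * (2 * pi / c) = 2 * pi" using c0 by simp
    finally have p: "?s2 ^ c = 1" by simp
    have eq: "poly (Npoly c) ?s2 = - (1 + cis (2 * (2 * pi / c)))" "poly (Dpoly c) ?s2 = 2 * ?s2"
      unfolding poly_Npoly poly_Dpoly power_Suc p by (auto simp: Complex.DeMoivre)
    \<comment> \<open>As \<open>c \<ge> 3\<close>, the angle lies strictly between 0 and pi; hence
      |1 + s^2| = 2 |cos| stays below |2 s| = 2.\<close>
    have "sin (2 * pi / c) > 0"
    proof (rule sin_gt_zero)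
      have "2 * pi < pi * c" using assms by simp
      then show "2 * pi / c < pi" using c0 by (simp add: field_simps)
    qed (use c0 in auto)
    then have "(cos (2 * pi / c))\<^sup>2 < 1"
      using sin_cos_squared_add[of "2 * pi / c"] zero_less_power[of "sin (2 * pi / c)" 2] by linarith
    then have "\<bar>cos (2 * pi / c)\<bar> < 1"
      by (simp only: abs_square_less_1)
    moreover have "1 + cis (2 * t) = 2 * of_real (cos t) * cis t" for t
      by (simp add: complex_eq_iff cos_double_cos sin_double power2_eq_square)
    then have "cmod (1 + cis (2 * (2 * pi / c))) = 2 * \<bar>cos (2 * pi / c)\<bar>"
      by (simp only: norm_mult norm_cis norm_of_real norm_numeral mult_1_right)
    ultimately show ?thesis
      unfolding f_def eq norm_minus_cancel by (simp add: norm_mult)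
  qed
  moreover have "open {s. f s > 0}" "open {s. f s < 0}"
    using cont by (auto intro!: open_Collect_less continuous_intros)
  ultimately obtain a b where a: "f a > 0" "cmod a > 1" "a \<notin> Bad" and b: "f b < 0" "cmod b > 1" "b \<notin> Bad"
    using exists_outside_disc_near_circle[of "{s. f s > 0}" ?s1 Bad]
      exists_outside_disc_near_circle[of "{s. f s < 0}" ?s2 Bad] fin by auto
  let ?\<Omega> = "- cball 0 1 - Bad"
  have "connected ?\<Omega>"
    using fin by (intro connected_open_delete_finite connected_complement_bounded_convex) auto
  then have "connected (f ` ?\<Omega>)"
    using cont continuous_on_subset by (intro connected_continuous_image) blast+
  then have "0 \<in> f ` ?\<Omega>"
    using a b unfolding is_interval_connected_1[symmetric]
    by (elim mem_is_interval_1_I[of _ "f b" "f a"]) auto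
  then obtain s where "s \<in> ?\<Omega>" "f s = 0" by auto
  then show ?thesis
    unfolding W_def[symmetric] by (intro exI[of _ s]) (auto simp: f_def Bad_def)
qed

text \<open>At the crossing point N/D has modulus 1 and nonzero derivative, as
  \<open>many_power_solutions\<close> requires. \<open>R\<close> is fixed before \<open>K\<close>
  and \<open>n\<close>, so that each root found contributes at least \<open>ln R\<close>.\<close>

lemma many_roots_outside_disc:
  assumes "c \<ge> 3"
  obtains R where "R > 1" "\<And>K. eventually (\<lambda>n. \<exists>F. card F = K \<and>
      F \<subseteq> {s. poly (Ppoly n c) s = 0 \<and> R \<le> cmod s}) sequentially"
proof -
  obtain s0 where s0: "cmod s0 > 1" "cmod (poly (Npoly c) s0) = cmod (poly (Dpoly c) s0)"
     "poly (Dpoly c) s0 \<noteq> 0" "poly Qpoly s0 \<noteq> 0"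
     "poly (pderiv (Npoly c) * Dpoly c - Npoly c * pderiv (Dpoly c)) s0 \<noteq> 0"
    using exists_crossing_outside_disc[OF assms] by blast
  \<comment> \<open>Halfway between 1 and the modulus of \<open>s0\<close>, so that a neighbourhood
    of \<open>s0\<close> stays outside radius \<open>R\<close>.\<close>
  define R where "R = (1 + cmod s0) / 2"
  define U where "U = {s. R < cmod s} \<inter> {s. poly (Dpoly c * Qpoly) s \<noteq> 0}"
  define z where "z s = poly (Npoly c) s / poly (Dpoly c) s" for s
  have "R > 1" using s0 by (simp add: R_def)
  have "open U"
    unfolding U_def by (intro open_Int open_Collect_less open_Collect_neq continuous_intros)
  have "s0 \<in> U" using s0 by (auto simp: U_def R_def)
  have der: "(z has_field_derivative
      poly (pderiv (Npoly c) * Dpoly c - Npoly c * pderiv (Dpoly c)) s / (poly (Dpoly c) s)\<^sup>2) (at s)"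
    if "s \<in> U" for s
    using that unfolding z_def U_def
    by (auto intro!: derivative_eq_intros simp: power2_eq_square)
  have hol: "z holomorphic_on U"
    using der \<open>open U\<close> by (auto simp: holomorphic_on_open)
  have der0: "deriv z s0 \<noteq> 0"
    using DERIV_imp_deriv[OF der[OF \<open>s0 \<in> U\<close>]] s0 by simp
  have norm: "cmod (z s0) = 1"
    using s0 by (simp add: z_def norm_divide)
  have nz: "s \<noteq> 0" if "s \<in> U" for s
    using that \<open>R > 1\<close> by (auto simp: U_def)
  have cont: "continuous_on U (\<lambda>s. - poly Qpoly s / s)"
    using nz by (intro continuous_intros) auto
  have hnz: "- poly Qpoly s / s \<noteq> 0" if "s \<in> U" for s
    using nz[OF that] that by (auto simp: U_def)
  have root: "poly (Ppoly n c) s = 0 \<and> R \<le> cmod s"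
    if s: "s \<in> U" "z s ^ n = - poly Qpoly s / s" for s n
  proof -
    have "poly (Dpoly c) s \<noteq> 0" using s by (auto simp: U_def)
    then have "poly (Npoly c) s ^ n = z s ^ n * poly (Dpoly c) s ^ n"
      by (simp add: z_def power_divide)
    then have "s * poly (Npoly c) s ^ n = - poly Qpoly s * poly (Dpoly c) s ^ n"
      unfolding s(2) using nz[OF s(1)] by simp
    then show ?thesis
      using s(1) by (simp add: poly_Ppoly U_def)
  qed
  have ev: "eventually (\<lambda>n. \<exists>F\<subseteq>U. card F = K \<and> (\<forall>s\<in>F. z s ^ n = - poly Qpoly s / s))
      sequentially" for K
    by (rule many_power_solutions[OF \<open>open U\<close> \<open>s0 \<in> U\<close> hol der0 norm cont]) (rule hnz)
  have "eventually (\<lambda>n. \<exists>F. card F = K \<and>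
      F \<subseteq> {s. poly (Ppoly n c) s = 0 \<and> R \<le> cmod s}) sequentially" for K
    using ev[of K]
  proof eventually_elim
    case (elim n)
    then obtain F where "F \<subseteq> U" "card F = K" "\<forall>s\<in>F. z s ^ n = - poly Qpoly s / s"
      by auto
    then show ?case
      using root by (intro exI[of _ F]) auto
  qed
  then show ?thesis
    using that \<open>R > 1\<close> by blast
qed

section \<open>Growth of the Mahler measure\<close>

text \<open>On the unit circle \<open>d * A\<^sup>2 = - (s + 1)\<close> equates the moduli of
  \<open>d\<close> and \<open>s + 1\<close>. Multiplying the closed form by the unimodular
  \<open>s * (- s) ^ n\<close> clears its denominators and yields \<open>Ppoly\<close>.\<close>

lemma norm_bracket:
  assumes "n > 0" "odd c" and A: "cmod A = 1" and s: "s = A ^ 4"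
  shows "cmod (pretzel_bracket n c A) * cmod (s + 1) ^ Suc n = cmod (poly (Ppoly n c) s)"
proof -
  define d where "d = - (A\<^sup>2) - inverse (A\<^sup>2)"
  have A0: "A \<noteq> 0" and s0: "s \<noteq> 0" using A s by auto
  have dA: "d * A\<^sup>2 = - (s + 1)"
    using A0 by (simp add: d_def s field_simps power2_eq_square power4_eq_xxxx)
  have norm_d: "cmod d = cmod (s + 1)"
    using arg_cong[OF dA, of cmod] A by (simp only: norm_mult norm_power norm_minus_cancel power_one mult_1_right)
  have "d\<^sup>2 * s = (d * A\<^sup>2)\<^sup>2"
    by (simp add: s power_mult_distrib flip: power_mult)
  then have d2: "d\<^sup>2 * s = (s + 1)\<^sup>2"
    unfolding dA by (simp only: power2_minus)
  have Q: "s * (d\<^sup>2 - 1) = poly Qpoly s"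
    using d2 by (simp add: poly_Qpoly algebra_simps power2_eq_square)
  have Ac: "A ^ (4 * c) = s ^ c"
    by (simp add: s power_mult)
  have N: "- s * (d\<^sup>2 - 1 - A ^ (4 * c)) = poly (Npoly c) s"
    using Q unfolding Ac by (simp add: poly_Npoly poly_Qpoly algebra_simps)
  have D: "- s * (- 1 - A ^ (4 * c)) = poly (Dpoly c) s"
    unfolding Ac by (simp add: poly_Dpoly algebra_simps)
  have "s * (- s) ^ n * (pretzel_bracket n c A * A ^ (n * c) * d ^ Suc n) =
      s * (- s * (d\<^sup>2 - 1 - A ^ (4 * c))) ^ n + s * (d\<^sup>2 - 1) * (- s * (- 1 - A ^ (4 * c))) ^ n"
    unfolding bracket_closed_form[OF assms(1,2) A0 d_def]
    by (simp only: power_mult_distrib distrib_left mult.assoc mult.left_commute)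
  also have "\<dots> = poly (Ppoly n c) s"
    unfolding Q N D poly_Ppoly ..
  finally have "cmod (s * (- s) ^ n * (pretzel_bracket n c A * A ^ (n * c) * d ^ Suc n)) =
      cmod (poly (Ppoly n c) s)"
    by (rule arg_cong)
  moreover have "cmod s = 1" using A s by (simp add: norm_power)
  ultimately show ?thesis
    using A norm_d by (simp only: norm_mult norm_power norm_minus_cancel power_one mult_1 mult_1_right)
qed

text \<open>The writhe factor is unimodular, and the denominator \<open>(s + 1) ^ Suc n\<close> has
  its only zero on the unit circle, where Jensen's formula gives 0; only the roots of the numerator
  contribute.\<close>

lemma pretzel_jones_mahler_eq:
  assumes "n > 0" "odd c"
  shows "pretzel_jones_mahler w n c =
    exp (\<Sum>z | poly (Ppoly n c) z = 0. of_nat (order z (Ppoly n c)) * ln (max 1 (cmod z)))"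
    (is "_ = exp ?I")
proof -
  have lc: "lead_coeff (Ppoly n c) = 1"
    using assms by (intro lead_coeff_Ppoly) (auto simp: Suc_le_eq intro: Nat.gr0I)
  define L where "L = [:1, 1::complex:]"
  have poly_L: "poly L z = z + 1" for z
    by (simp add: L_def)
  have "Ppoly n c \<noteq> 0" "L \<noteq> 0"
    using lc by (auto simp: L_def)
  then have nz: "Ppoly n c * L \<noteq> 0" by simp
  let ?s = "\<lambda>x. cis (- (2 * pi * x))"
  have "((\<lambda>x. ln (cmod (poly (Ppoly n c) (?s x))) - real (Suc n) * ln (cmod (?s x - (- 1))))
      has_integral ?I - real (Suc n) * ln (max 1 (cmod (- 1)))) {0..1}"
    by (intro has_integral_diff has_integral_mult_right jensen_poly[OF lc] jensen_linear)
  then have int: "((\<lambda>x. ln (cmod (poly (Ppoly n c) (?s x))) - real (Suc n) * ln (cmod (?s x + 1)))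
      has_integral ?I) {0..1}"
    by simp
  have eq: "ln (cmod (pretzel_jones_A w n c (cis (- (pi * x / 2))))) =
      ln (cmod (poly (Ppoly n c) (?s x))) - real (Suc n) * ln (cmod (?s x + 1))"
    if x: "x \<in> {0..1} - {x \<in> {0..1}. poly (Ppoly n c * L) (?s x) = 0}" for x
  proof -
    let ?A = "cis (- (pi * x / 2))"
    have P0: "poly (Ppoly n c) (?s x) \<noteq> 0" and s1: "?s x \<noteq> - 1"
      using x by (auto simp: poly_L)
    have s1': "cmod (?s x + 1) > 0"
      using s1 by (simp add: add_eq_0_iff2)
    have "?s x = ?A ^ 4"
      by (simp add: Complex.DeMoivre mult.assoc)
    from norm_bracket[OF assms norm_cis this]
    have br: "cmod (pretzel_bracket n c ?A) * cmod (?s x + 1) ^ Suc n = cmod (poly (Ppoly n c) (?s x))" .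
    have "cmod (pretzel_jones_A w n c ?A) = cmod (pretzel_bracket n c ?A)"
      by (simp add: pretzel_jones_A_def norm_mult norm_power_int norm_power)
    moreover have "cmod (pretzel_bracket n c ?A) > 0"
      using br P0 by (metis mult_zero_left norm_eq_zero zero_less_norm_iff)
    ultimately show ?thesis
      unfolding br[symmetric] using s1' by (simp add: ln_mult_pos ln_realpow del: power_Suc)
  qed
  have "((\<lambda>x. ln (cmod (pretzel_jones_A w n c (cis (- (pi * x / 2)))))) has_integral ?I) {0..1}"
    by (rule has_integral_spike_finite[OF finite_circle_roots[OF nz] eq int])
  then show ?thesis
    unfolding pretzel_jones_mahler_def mahler_measure_circle_def by (simp only: integral_unique)
qed

text \<open>\<open>w\<close> is arbitrary: the writhe enters only through a unimodular factor, so
  every orientation is covered.\<close>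

theorem theorem4p1:
  fixes k :: nat and w :: "nat \<Rightarrow> int"
  assumes "k \<ge> 1"
  shows "filterlim (\<lambda>n. pretzel_jones_mahler (w n) n (2*k+1)) at_top sequentially"
proof -
  let ?c = "2 * k + 1"
  have c: "?c \<ge> 3" "odd ?c" using assms by auto
  obtain R where R: "R > 1" and roots: "\<And>K. eventually (\<lambda>n. \<exists>F. card F = K \<and>
      F \<subseteq> {s. poly (Ppoly n ?c) s = 0 \<and> R \<le> cmod s}) sequentially"
    using many_roots_outside_disc[OF c(1)] by blast
  show ?thesis
    unfolding filterlim_at_top
  proof
    fix Y :: real
    \<comment> \<open>\<open>K\<close> roots of modulus at least \<open>R\<close> force a measure of
      at least \<open>exp (K * ln R)\<close>; since exp x >= x, it suffices that
      \<open>K * ln R\<close> reaches \<open>Y\<close>.\<close>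
    obtain K :: nat where K: "Y / ln R \<le> real K"
      using real_arch_simple by blast
    have "Y \<le> real K * ln R"
      using K R by (simp add: field_simps)
    then have Y: "Y \<le> exp (real K * ln R)"
      using exp_ge_add_one_self[of "real K * ln R"] by linarith
    show "eventually (\<lambda>n. Y \<le> pretzel_jones_mahler (w n) n ?c) sequentially"
      using roots[of K] eventually_gt_at_top[of 0]
    proof eventually_elim
      case (elim n)
      then obtain F where F: "card F = K" "F \<subseteq> {s. poly (Ppoly n ?c) s = 0 \<and> R \<le> cmod s}"
        by blast
      have "lead_coeff (Ppoly n ?c) = 1"
        by (rule lead_coeff_Ppoly) simp
      then have "real K * ln R \<le>
          (\<Sum>z | poly (Ppoly n ?c) z = 0. of_nat (order z (Ppoly n ?c)) * ln (max 1 (cmod z)))"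
        using jensen_poly_ge[OF _ _ F(2)] F(1) R by simp
      then show ?case
        unfolding pretzel_jones_mahler_eq[OF elim(2) c(2)] using Y by (meson exp_le_cancel_iff order_trans)
    qed
  qed
qed

end
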